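(* Let $d \geq 3$ be an integer, let $\mathbb{F}$ be a field, and let $V$ be a vector space over $\mathbb{F}$ of dimension $d+1$. Let $\Phi = (A; \{E_i\}_{i=0}^d; A^*; \{E^*_i\}_{i=0}^d)$ be a Hessenberg system on $V$ with parameter array $(\{\theta_i\}_{i=0}^d; \{\theta^*_i\}_{i=0}^d; \{\phi_i\}_{i=1}^d)$, and let $\vartheta_0=\vartheta_{d+1}=0$ and $\vartheta_i=\phi_i-(\theta^*_i-\theta^*_0)(\theta_{d-i+1}-\theta_0)$ for $1\le i\le d$. Then the following are equivalent: (i) $E_iA^*E_j=0$ whenever $1<j-i$ $(0\le i,j\le d)$; (ii) $E^*_iAE^*_j=0$ whenever $1<j-i$ $(0\le i,j\le d)$; (iii) $\vartheta_1=\vartheta_d$ and there exists $\beta\in\mathbb{F}$ such that each of $\{\theta_i\}_{i=0}^d$, $\{\theta^*_i\}_{i=0}^d$, $\{\vartheta_i\}_{i=0}^{d+1}$ is $\beta$-recurrent; (iv) $\Phi$ is a Tridiagonal Hessenberg system (THS).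
   Context: $\mathrm{End}(V)$ is the algebra of $\mathbb{F}$-linear maps $V\to V$. An element of $\mathrm{End}(V)$ is multiplicity-free if it is diagonalizable and every eigenspace has dimension one. For multiplicity-free $A$ with eigenspaces ordered $V_0,\dots,V_d$, the corresponding primitive idempotents are $E_0,\dots,E_d \in \mathrm{End}(V)$, where $E_i$ acts as the identity on $V_i$ and as $0$ on $V_j$ for $j\neq i$. The superscript $*$ in $A^*$, $E_i^*$, $\theta_i^*$ is just notation (not an adjoint). A Hessenberg system on $V$ is a sequence $\Phi=(A; \{E_i\}_{i=0}^d; A^*; \{E^*_i\}_{i=0}^d)$ of elements of $\mathrm{End}(V)$ such that: (i) $A$ and $A^*$ are multiplicity-free; (ii) $\{E_i\}_{i=0}^d$ is an ordering of the primitive idempotents of $A$; (iii) $\{E^*_i\}_{i=0}^d$ is an ordering of the primitive idempotents of $A^*$; (iv) for $0\le i,j\le d$, $E_iA^*E_j=0$ if $i-j>1$ and $E_iA^*E_j\neq 0$ if $i-j=1$; (v) for $0\le i,j\le d$, $E^*_iAE^*_j=0$ if $i-j>1$ and $E^*_iAE^*_j\neq 0$ if $i-j=1$. The parameter array of $\Phi$ is $(\{\theta_i\}_{i=0}^d; \{\theta^*_i\}_{i=0}^d; \{\phi_i\}_{i=1}^d)$, defined as follows. $\theta_i$ (resp. $\theta^*_i$) is the eigenvalue of $A$ (resp. $A^*$) on $E_iV$ (resp. $E^*_iV$). For $0\le i\le d$ put $U_i=(E^*_0V+\cdots+E^*_iV)\cap(E_0V+\cdots+E_{d-i}V)$; it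 is known that $\dim U_i=1$, $V=\bigoplus_{i=0}^d U_i$, $(A-\theta_{d-i}I)U_i=U_{i+1}$ $(0\le i\le d-1)$ and $(A^*-\theta^*_iI)U_i=U_{i-1}$ $(1\le i\le d)$. For $1\le i\le d$, $\phi_i$ is the unique nonzero scalar such that $(A-\theta_{d-i+1}I)(A^*-\theta^*_iI)$ acts on $U_i$ as $\phi_i I$. A sequence $\{\sigma_i\}_{i=0}^n$ in $\mathbb{F}$ is $\beta$-recurrent ($\beta\in\mathbb{F}$) if $\sigma_{i-2}-(\beta+1)\sigma_{i-1}+(\beta+1)\sigma_i-\sigma_{i+1}=0$ for $2\le i\le n-1$. A Hessenberg system $\Phi$ is a Tridiagonal Hessenberg system (THS) if for all $0\le i,j\le d$ with $1<j-i$ we have both $E_iA^*E_j=0$ and $E^*_iAE^*_j=0$. *)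

theory Defs
  imports "HOL.Vector_Spaces"
begin

definition sum_of_ranges :: "(nat \<Rightarrow> 'b::ab_group_add \<Rightarrow> 'b) \<Rightarrow> nat \<Rightarrow> 'b set" where
  "sum_of_ranges E n = {\<Sum>h\<le>n. w h | w. \<forall>h\<le>n. w h \<in> range (E h)}"

definition split_space ::
  "nat \<Rightarrow> (nat \<Rightarrow> 'b::ab_group_add \<Rightarrow> 'b) \<Rightarrow> (nat \<Rightarrow> 'b \<Rightarrow> 'b) \<Rightarrow> nat \<Rightarrow> 'b set" where
  "split_space d E Es i = sum_of_ranges Es i \<inter> sum_of_ranges E (d - i)"

context vector_space
begin

definition eigenspace :: "('b \<Rightarrow> 'b) \<Rightarrow> 'a \<Rightarrow> 'b set" where
  "eigenspace A t = {v. A v = t *s v}"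

definition eigenvalues :: "('b \<Rightarrow> 'b) \<Rightarrow> 'a set" where
  "eigenvalues A = {t. eigenspace A t \<noteq> {0}}"

definition diagonalizable :: "('b \<Rightarrow> 'b) \<Rightarrow> bool" where
  "diagonalizable A \<longleftrightarrow>
     (\<exists>B. independent B \<and> span B = UNIV \<and> (\<forall>v\<in>B. \<exists>t. v \<in> eigenspace A t))"

definition multiplicity_free :: "('b \<Rightarrow> 'b) \<Rightarrow> bool" where
  "multiplicity_free A \<longleftrightarrow>
     Vector_Spaces.linear scale scale A \<and> diagonalizable A \<and>
     (\<forall>t\<in>eigenvalues A. dim (eigenspace A t) = 1)"

text \<open>The witness \<open>th\<close> is the ordering of the eigenspaces that underlies the ordering of the
  idempotents. Families indexed by \<open>0, \<dots>, d\<close> are functions on \<open>nat\<close> whose values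
  beyond \<open>d\<close> are irrelevant.\<close>

definition primitive_idempotents :: "nat \<Rightarrow> ('b \<Rightarrow> 'b) \<Rightarrow> (nat \<Rightarrow> 'b \<Rightarrow> 'b) \<Rightarrow> bool" where
  "primitive_idempotents d A E \<longleftrightarrow>
     (\<exists>th. bij_betw th {0..d} (eigenvalues A) \<and>
       (\<forall>i\<le>d. Vector_Spaces.linear scale scale (E i) \<and>
         (\<forall>j\<le>d. \<forall>v\<in>eigenspace A (th j). E i v = (if i = j then v else 0))))"

definition hessenberg_system ::
  "nat \<Rightarrow> ('b \<Rightarrow> 'b) \<Rightarrow> (nat \<Rightarrow> 'b \<Rightarrow> 'b) \<Rightarrow> ('b \<Rightarrow> 'b) \<Rightarrow> (nat \<Rightarrow> 'b \<Rightarrow> 'b) \<Rightarrow> bool" where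
  "hessenberg_system d A E As Es \<longleftrightarrow>
     multiplicity_free A \<and> multiplicity_free As \<and>
     primitive_idempotents d A E \<and> primitive_idempotents d As Es \<and>
     (\<forall>i\<le>d. \<forall>j\<le>d. (i > j + 1 \<longrightarrow> E i \<circ> As \<circ> E j = (\<lambda>_. 0)) \<and>
                   (i = j + 1 \<longrightarrow> E i \<circ> As \<circ> E j \<noteq> (\<lambda>_. 0))) \<and>
     (\<forall>i\<le>d. \<forall>j\<le>d. (i > j + 1 \<longrightarrow> Es i \<circ> A \<circ> Es j = (\<lambda>_. 0)) \<and>
                   (i = j + 1 \<longrightarrow> Es i \<circ> A \<circ> Es j \<noteq> (\<lambda>_. 0)))"

definition tridiagonal_hessenberg_system ::
  "nat \<Rightarrow> ('b \<Rightarrow> 'b) \<Rightarrow> (nat \<Rightarrow> 'b \<Rightarrow> 'b) \<Rightarrow> ('b \<Rightarrow> 'b) \<Rightarrow> (nat \<Rightarrow> 'b \<Rightarrow> 'b) \<Rightarrow> bool" where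
  "tridiagonal_hessenberg_system d A E As Es \<longleftrightarrow>
     hessenberg_system d A E As Es \<and>
     (\<forall>i\<le>d. \<forall>j\<le>d. j > i + 1 \<longrightarrow>
        E i \<circ> As \<circ> E j = (\<lambda>_. 0) \<and> Es i \<circ> A \<circ> Es j = (\<lambda>_. 0))"

definition eigenvalue_on :: "('b \<Rightarrow> 'b) \<Rightarrow> 'b set \<Rightarrow> 'a" where
  "eigenvalue_on A W = (THE t. \<forall>v\<in>W. A v = t *s v)"

text \<open>For a Hessenberg system on a space of dimension \<open>d + 1\<close>, the scalars described by \<open>THE\<close>
  exist and are unique, because the spaces \<open>E\<^sub>iV\<close> and \<open>U\<^sub>i\<close> have dimension one.\<close>

definition parameter_array ::
  "nat \<Rightarrow> ('b \<Rightarrow> 'b) \<Rightarrow> (nat \<Rightarrow> 'b \<Rightarrow> 'b) \<Rightarrow> ('b \<Rightarrow> 'b) \<Rightarrow> (nat \<Rightarrow> 'b \<Rightarrow> 'b) \<Rightarrow>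
   (nat \<Rightarrow> 'a) \<Rightarrow> (nat \<Rightarrow> 'a) \<Rightarrow> (nat \<Rightarrow> 'a) \<Rightarrow> bool" where
  "parameter_array d A E As Es \<theta> \<theta>s \<phi> \<longleftrightarrow>
     (\<forall>i\<le>d. \<theta> i = eigenvalue_on A (range (E i))) \<and>
     (\<forall>i\<le>d. \<theta>s i = eigenvalue_on As (range (Es i))) \<and>
     (\<forall>i\<in>{1..d}. \<phi> i = (THE c. c \<noteq> 0 \<and>
        (\<forall>u\<in>split_space d E Es i.
           ((\<lambda>v. A v - \<theta> (d - i + 1) *s v) \<circ> (\<lambda>v. As v - \<theta>s i *s v)) u = c *s u)))"

end

definition beta_recurrent :: "'a::field \<Rightarrow> nat \<Rightarrow> (nat \<Rightarrow> 'a) \<Rightarrow> bool" where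
  "beta_recurrent \<beta> n \<sigma> \<longleftrightarrow>
     (\<forall>i. 2 \<le> i \<and> i + 1 \<le> n \<longrightarrow>
        \<sigma> (i - 2) - (\<beta> + 1) * \<sigma> (i - 1) + (\<beta> + 1) * \<sigma> i - \<sigma> (i + 1) = 0)"

end

theory Submission
  imports Defs Main
begin

text \<open>
  Choose a vector \<open>u\<^sub>0\<close> spanning \<open>E*\<^sub>0V\<close> and put \<open>u\<^sub>i\<^sub>+\<^sub>1 = (A - \<theta>\<^sub>d\<^sub>-\<^sub>i) u\<^sub>i\<close>.
  Then \<open>u\<^sub>i\<close> spans \<open>U\<^sub>i\<close>, the map \<open>A\<close> is lower bidiagonal and \<open>A*\<close> is upper bidiagonal in
  this basis, with entries read off the parameter array.

  If the three sequences are recurrent, a computation in this basis gives the Askey-Wilson relation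
  \<open>A\<^sup>2A* - \<beta>AA*A + A*A\<^sup>2 - \<gamma>(AA* + A*A) - \<rho>A* = \<gamma>*A\<^sup>2 + \<omega>A + \<nu>\<close>. Sandwiching it between \<open>E\<^sub>i\<close> and
  \<open>E\<^sub>j\<close> kills \<open>E\<^sub>iA*E\<^sub>j\<close> for \<open>j - i > 1\<close>, except possibly for \<open>(i, j) = (0, d)\<close>. For that
  corner, evaluating \<open>E\<^sub>0A*\<close> on \<open>u\<^sub>0, u\<^sub>1, u\<^sub>d\<close> shows that \<open>E\<^sub>0A*E\<^sub>d = 0\<close> is equivalent to
  \<open>\<vartheta>\<^sub>1 = \<vartheta>\<^sub>d\<close>.

  Conversely, if \<open>A*\<close> is tridiagonal with respect to \<open>A\<close>, then \<open>A\<^sup>2A*A - AA*A\<^sup>2 = ZA* - A*Z\<close> for some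
  \<open>Z\<close> commuting with \<open>A\<close>. Applied to \<open>u\<^sub>0\<close> this forces \<open>Z\<close> to be a cubic polynomial in \<open>A\<close>, and the
  three recurrences are coefficients of the resulting relation.

  The condition on \<open>E*\<^sub>iAE*\<^sub>j\<close> follows by exchanging \<open>A\<close> and \<open>A*\<close>: this reverses
  \<open>\<phi>\<close> and \<open>\<vartheta>\<close>, and recurrence is invariant under reversal.
\<close>

section \<open>Linear maps and frames of rank-one idempotents\<close>

context vector_space
begin

lemma linear_rules:
  assumes "Vector_Spaces.linear scale scale f"
  shows "f (x + y) = f x + f y" and "f (x - y) = f x - f y" and "f (c *s x) = c *s f x"
    and "f 0 = 0" and "f (sum g S) = (\<Sum>a\<in>S. f (g a))"
proof -
  interpret module_hom scale scale f
    using assms by (simp add: module_hom_iff_linear)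
  show "f (x + y) = f x + f y" "f (x - y) = f x - f y" "f (c *s x) = c *s f x"
    "f 0 = 0" "f (sum g S) = (\<Sum>a\<in>S. f (g a))"
    by (simp_all add: add diff scale sum)
qed

lemma span_induct_UNIV:
  assumes "span B = UNIV" and "P 0" and "\<And>x. x \<in> B \<Longrightarrow> P x"
    and "\<And>x y. P x \<Longrightarrow> P y \<Longrightarrow> P (x + y)" and "\<And>c x. P x \<Longrightarrow> P (c *s x)"
  shows "P v"
proof -
  have "v \<in> span B" using assms(1) by simp
  then show ?thesis
  proof (induction rule: span_induct_alt)
    case base then show ?case by (rule assms(2))
  next
    case (step c x y) then show ?case using assms(3-5) by blast
  qed
qed

end

text \<open>The primitive idempotents of a multiplicity-free map with their ordered eigenvalues, in
  the form used for computation. \<open>E_rank\<close> expresses without reference to dimension that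
  the range of \<open>E i\<close> is at most a line.\<close>

locale idempotent_frame = vector_space scale
  for scale :: "'f::field \<Rightarrow> 'v::ab_group_add \<Rightarrow> 'v" (infixr "*s" 75) +
  fixes d :: nat and A :: "'v \<Rightarrow> 'v" and E :: "nat \<Rightarrow> 'v \<Rightarrow> 'v" and \<theta> :: "nat \<Rightarrow> 'f"
  assumes linear_A: "Vector_Spaces.linear scale scale A"
    and linear_E: "i \<le> d \<Longrightarrow> Vector_Spaces.linear scale scale (E i)"
    and sum_E: "(\<Sum>i\<le>d. E i v) = v"
    and E_E: "i \<le> d \<Longrightarrow> j \<le> d \<Longrightarrow> E i (E j v) = (if i = j then E i v else 0)"
    and A_E: "i \<le> d \<Longrightarrow> A (E i v) = \<theta> i *s E i v"
    and E_rank: "i \<le> d \<Longrightarrow> E i x \<noteq> 0 \<Longrightarrow> \<exists>c. E i y = c *s E i x"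
    and E_nonzero: "i \<le> d \<Longrightarrow> \<exists>v. E i v \<noteq> 0"
    and inj_\<theta>: "inj_on \<theta> {..d}"
begin

lemmas A_simps = linear_rules[OF linear_A]
lemmas E_simps = linear_rules[OF linear_E]

lemma \<theta>_eq_iff: "i \<le> d \<Longrightarrow> j \<le> d \<Longrightarrow> \<theta> i = \<theta> j \<longleftrightarrow> i = j"
  using inj_\<theta> by (auto simp: inj_on_def)

lemma E_A: assumes "i \<le> d" shows "E i (A v) = \<theta> i *s E i v"
proof -
  have "A v = A (\<Sum>j\<le>d. E j v)" by (simp add: sum_E)
  also have "\<dots> = (\<Sum>j\<le>d. \<theta> j *s E j v)" by (simp add: A_simps A_E)
  finally have "E i (A v) = (\<Sum>j\<le>d. \<theta> j *s E i (E j v))"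
    using assms by (simp add: E_simps)
  also have "\<dots> = (\<Sum>j\<le>d. if j = i then \<theta> j *s E j v else 0)"
    using assms by (intro sum.cong) (auto simp: E_E)
  also have "\<dots> = \<theta> i *s E i v" using assms by simp
  finally show ?thesis .
qed

lemma vector_eqI: assumes "\<And>i. i \<le> d \<Longrightarrow> E i v = E i w" shows "v = w"
proof -
  have "(\<Sum>i\<le>d. E i v) = (\<Sum>i\<le>d. E i w)" using assms by (intro sum.cong) auto
  then show ?thesis by (simp add: sum_E)
qed

text \<open>Orthogonality of the idempotents turns membership into the vanishing of the components
  above \<open>n\<close>, so membership in \<open>split_space\<close> can be tested one component at
  a time.\<close>

lemma sum_of_ranges_eq:
  assumes "n \<le> d" shows "sum_of_ranges E n = {v. \<forall>h\<le>d. n < h \<longrightarrow> E h v = 0}"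
proof (intro set_eqI iffI)
  fix v assume "v \<in> sum_of_ranges E n"
  then obtain w where v: "v = (\<Sum>h\<le>n. w h)" and w: "\<forall>h\<le>n. w h \<in> range (E h)"
    unfolding sum_of_ranges_def by auto
  have "E k v = 0" if "k \<le> d" "n < k" for k
  proof -
    have "E k (w h) = 0" if "h \<le> n" for h
      using w \<open>k \<le> d\<close> \<open>n < k\<close> that assms by (auto simp: E_E)
    then show ?thesis unfolding v using that by (simp add: E_simps)
  qed
  then show "v \<in> {v. \<forall>h\<le>d. n < h \<longrightarrow> E h v = 0}" by simp
next
  fix v assume v: "v \<in> {v. \<forall>h\<le>d. n < h \<longrightarrow> E h v = 0}"
  have "(\<Sum>h\<le>d. E h v) = (\<Sum>h\<le>n. E h v)"
    using v assms by (intro sum.mono_neutral_right) auto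
  then have "v = (\<Sum>h\<le>n. E h v)" by (simp add: sum_E)
  then show "v \<in> sum_of_ranges E n"
    unfolding sum_of_ranges_def by blast
qed

end

section \<open>Hessenberg systems and their split basis\<close>

locale hessenberg_frame =
  idempotent_frame scale d A E \<theta> + star: idempotent_frame scale d As Es \<theta>s
  for scale :: "'f::field \<Rightarrow> 'v::ab_group_add \<Rightarrow> 'v" (infixr "*s" 75)
    and d A E As Es \<theta> \<theta>s +
  assumes hessenberg_zero: "i \<le> d \<Longrightarrow> j + 1 < i \<Longrightarrow> E i (As (E j v)) = 0"
    and hessenberg_nonzero: "j < d \<Longrightarrow> \<exists>v. E (Suc j) (As (E j v)) \<noteq> 0"
    and hessenberg_zero': "i \<le> d \<Longrightarrow> j + 1 < i \<Longrightarrow> Es i (A (Es j v)) = 0"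
    and hessenberg_nonzero': "j < d \<Longrightarrow> \<exists>v. Es (Suc j) (A (Es j v)) \<noteq> 0"
begin

text \<open>The locale is symmetric in \<open>(A, E, \<theta>)\<close> and
  \<open>(As, Es, \<theta>s)\<close>, so each of its results is available with the two roles
  exchanged.\<close>

lemma dual: "hessenberg_frame scale d As Es A E \<theta>s \<theta>"
  by unfold_locales (fact hessenberg_zero hessenberg_nonzero hessenberg_zero' hessenberg_nonzero')+

lemma E_As_expand: "i \<le> d \<Longrightarrow> E i (As v) = (\<Sum>j\<le>d. E i (As (E j v)))"
proof -
  assume "i \<le> d"
  have "As v = As (\<Sum>j\<le>d. E j v)" by (simp add: sum_E)
  then show ?thesis using \<open>i \<le> d\<close> by (simp add: E_simps star.A_simps)
qed

text \<open>The range of \<open>E j\<close> is a line: if \<open>E (Suc j)\<close> after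
  \<open>As\<close> killed one nonzero vector of it, it would kill the whole range.\<close>

lemma E_As_nonzero: assumes "j < d" "E j x \<noteq> 0" shows "E (Suc j) (As (E j x)) \<noteq> 0"
proof
  assume *: "E (Suc j) (As (E j x)) = 0"
  obtain v where v: "E (Suc j) (As (E j v)) \<noteq> 0" using hessenberg_nonzero assms by blast
  obtain c where "E j v = c *s E j x" using E_rank[of j x v] assms by auto
  then show False using v * assms by (simp add: E_simps star.A_simps)
qed

text \<open>\<open>\<phi> 0 = \<phi> (d + 1) = 0\<close> and \<open>u i = 0\<close> for \<open>i > d\<close> make the two action rules
  hold without boundary cases.\<close>

definition split_basis :: "(nat \<Rightarrow> 'v) \<Rightarrow> (nat \<Rightarrow> 'f) \<Rightarrow> bool" where
  "split_basis u \<phi> \<longleftrightarrow>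
     (\<forall>i>d. u i = 0) \<and> \<phi> 0 = 0 \<and> \<phi> (d + 1) = 0 \<and> (\<forall>i\<in>{1..d}. \<phi> i \<noteq> 0) \<and>
     (\<forall>i\<le>d. A (u i) = \<theta> (d - i) *s u i + u (i + 1)) \<and>
     (\<forall>i\<le>d. As (u i) = \<theta>s i *s u i + \<phi> i *s u (i - 1)) \<and>
     (\<forall>v. \<exists>c. v = (\<Sum>k\<le>d. c k *s u k)) \<and>
     (\<forall>c. (\<Sum>k\<le>d. c k *s u k) = 0 \<longrightarrow> (\<forall>k\<le>d. c k = 0))"

text \<open>The vectors \<open>u i\<close> are triangular in two ways: the \<open>Es\<close>
  components of \<open>u i\<close> stop at index \<open>i\<close>, the \<open>E\<close> components
  at index \<open>d - i\<close>, and both last components are nonzero. Spanning, independence and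
  the form of the split spaces come from eliminating against these components.\<close>

lemma split_basis_exists:
  obtains u \<phi> where "split_basis u \<phi>"
    and "\<And>i. i \<le> d \<Longrightarrow> split_space d E Es i = {c *s u i | c. True}"
proof -
  obtain u0 where u0: "Es 0 u0 \<noteq> 0" using star.E_nonzero[of 0] by auto
  define u where "u = rec_nat (Es 0 u0) (\<lambda>i x. A x - \<theta> (d - i) *s x)"
  have u_0: "u 0 = Es 0 u0" and u_Suc: "u (Suc i) = A (u i) - \<theta> (d - i) *s u i" for i
    by (simp_all add: u_def)
  have A_u: "A (u i) = \<theta> (d - i) *s u i + u (i + 1)" for i by (simp add: u_Suc)
  interpret D: hessenberg_frame scale d As Es A E \<theta>s \<theta> by (rule dual)
  \<comment> \<open>By the Hessenberg condition \<open>A\<close> raises the \<open>Es\<close> index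
    by at most one.\<close>
  have Es_u: "h \<le> d \<Longrightarrow> i < h \<Longrightarrow> Es h (u i) = 0" for i h
  proof (induction i arbitrary: h)
    case 0 then show ?case by (simp add: u_0 star.E_E)
  next
    case (Suc i)
    have "Es h (A (Es j (u i))) = 0" if "j \<le> d" for j
    proof (cases "j \<le> i")
      case True then show ?thesis using Suc.prems hessenberg_zero' by simp
    next
      case False then show ?thesis using Suc that by (simp add: A_simps star.E_simps)
    qed
    then have "Es h (A (u i)) = 0" using Suc.prems by (subst D.E_As_expand) simp_all
    then show ?case using Suc by (simp add: u_Suc star.E_simps)
  qed
  \<comment> \<open>In the component at \<open>Suc i\<close> only \<open>j = i\<close> survives:
    smaller \<open>j\<close> fall to the Hessenberg condition, larger \<open>j\<close> to
    \<open>Es_u\<close>. The surviving subdiagonal block is nonzero.\<close>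
  have Es_u_diag: "i \<le> d \<Longrightarrow> Es i (u i) \<noteq> 0" for i
  proof (induction i)
    case 0 then show ?case using u0 by (simp add: u_0 star.E_E)
  next
    case (Suc i)
    have "(\<Sum>j\<le>d. Es (Suc i) (A (Es j (u i)))) = (\<Sum>j\<le>d. if j = i then Es (Suc i) (A (Es i (u i))) else 0)"
    proof (intro sum.cong refl)
      fix j assume "j \<in> {..d}"
      then show "Es (Suc i) (A (Es j (u i))) = (if j = i then Es (Suc i) (A (Es i (u i))) else 0)"
        using Suc.prems hessenberg_zero'[of "Suc i" j] Es_u[of j i]
        by (cases "j < i"; cases "j = i") (auto simp: A_simps star.E_simps)
    qed
    also have "\<dots> = Es (Suc i) (A (Es i (u i)))" using Suc.prems by simp
    finally have "Es (Suc i) (A (u i)) \<noteq> 0"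
      using D.E_As_expand[of "Suc i" "u i"] D.E_As_nonzero[of i "u i"] Suc by simp
    then show ?case using Suc.prems Es_u[of "Suc i" i] by (simp add: u_Suc star.E_simps)
  qed
  have E_u_Suc: "h \<le> d \<Longrightarrow> E h (u (Suc i)) = (\<theta> h - \<theta> (d - i)) *s E h (u i)" for h i
    by (simp add: u_Suc E_simps E_A algebra_simps)
  \<comment> \<open>Passing from \<open>u i\<close> to \<open>u (Suc i)\<close> kills the component
    at \<open>d - i\<close>, and components already lost stay lost.\<close>
  have E_u: "h \<le> d \<Longrightarrow> d < h + i \<Longrightarrow> E h (u i) = 0" for h i
  proof (induction i)
    case (Suc i)
    show ?case
    proof (cases "d < h + i")
      case True then show ?thesis using Suc by (simp add: E_u_Suc)
    next
      case False
      then have "h = d - i" using Suc.prems by simp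
      then show ?thesis using Suc.prems by (simp add: E_u_Suc)
    qed
  qed simp
  have u_zero: "u i = 0" if "d < i" for i
    by (rule vector_eqI) (use that in \<open>simp add: E_u E_simps\<close>)
  have Es_span: "n \<le> d + 1 \<Longrightarrow> (\<And>h. n \<le> h \<Longrightarrow> h \<le> d \<Longrightarrow> Es h v = 0) \<Longrightarrow>
      \<exists>c. v = (\<Sum>k<n. c k *s u k)" for n v
  proof (induction n arbitrary: v)
    case 0
    have "v = 0" by (rule star.vector_eqI) (simp add: 0 star.E_simps)
    then show ?case by simp
  next
    case (Suc n)
    then obtain b where b: "Es n v = b *s Es n (u n)"
      using star.E_rank[of n "u n" v] Es_u_diag[of n] by auto
    have "Es h (v - b *s u n) = 0" if "n \<le> h" "h \<le> d" for h
      using that Suc.prems b Es_u[of h n] by (cases "h = n") (auto simp: star.E_simps)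
    with Suc obtain c where "v - b *s u n = (\<Sum>k<n. c k *s u k)" by fastforce
    then have "v = (\<Sum>k<Suc n. (c(n := b)) k *s u k)" by (simp add: algebra_simps)
    then show ?case by blast
  qed
  have spans: "\<exists>c. v = (\<Sum>k\<le>d. c k *s u k)" for v
    using Es_span[of "d + 1" v] by (simp add: lessThan_Suc_atMost)
  \<comment> \<open>Otherwise \<open>E h\<close> would vanish on every \<open>u k\<close>, hence
    everywhere, because the \<open>u k\<close> span.\<close>
  have E_u_0: "E h (u 0) \<noteq> 0" if "h \<le> d" for h
  proof
    assume 0: "E h (u 0) = 0"
    have "E h (u k) = 0" for k by (induction k) (simp_all add: 0 E_u_Suc that)
    then have "E h v = 0" for v using spans[of v] that by (auto simp: E_simps)
    then show False using E_nonzero that by blast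
  qed
  have E_u_nonzero: "h + k \<le> d \<Longrightarrow> E h (u k) \<noteq> 0" for h k
    by (induction k) (auto simp: E_u_0 E_u_Suc \<theta>_eq_iff)
  \<comment> \<open>\<open>E (d - k)\<close> kills \<open>u j\<close> for \<open>j > k\<close>, so
    coefficients can be read off in increasing order. The case \<open>n = d + 1\<close> is
    independence; the case \<open>n = i\<close> serves the split spaces.\<close>
  have E_triangular: "\<forall>k<n. c k = 0"
    if "n \<le> d + 1" "\<And>h. h \<le> d \<Longrightarrow> d < h + n \<Longrightarrow> E h (\<Sum>k\<le>d. c k *s u k) = 0" for n c
  proof (intro allI impI)
    fix k assume "k < n"
    then show "c k = 0"
    proof (induction k rule: less_induct)
      case (less k)
      have k: "k \<le> d" using less.prems that(1) by simp
      have "E (d - k) (\<Sum>j\<le>d. c j *s u j) = (\<Sum>j\<le>d. c j *s E (d - k) (u j))"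
        by (simp add: E_simps)
      also have "\<dots> = (\<Sum>j\<le>d. if j = k then c k *s E (d - k) (u k) else 0)"
      proof (intro sum.cong refl)
        fix j assume "j \<in> {..d}"
        then show "c j *s E (d - k) (u j) = (if j = k then c k *s E (d - k) (u k) else 0)"
          using less.IH[of j] less.prems k E_u[of "d - k" j] by (cases j k rule: linorder_cases) auto
      qed
      also have "\<dots> = c k *s E (d - k) (u k)" using k by simp
      finally show ?case using that(2)[of "d - k"] less.prems k E_u_nonzero[of "d - k" k] by auto
    qed
  qed
  have split: "split_space d E Es i = {c *s u i | c. True}" if i: "i \<le> d" for i
  proof (intro set_eqI iffI)
    fix v assume "v \<in> split_space d E Es i"
    then have v: "\<And>h. h \<le> d \<Longrightarrow> i < h \<Longrightarrow> Es h v = 0" "\<And>h. h \<le> d \<Longrightarrow> d - i < h \<Longrightarrow> E h v = 0"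
      using that by (auto simp: split_space_def sum_of_ranges_eq star.sum_of_ranges_eq)
    obtain c where c: "v = (\<Sum>k<Suc i. c k *s u k)" using Es_span[of "Suc i" v] v i by auto
    let ?c = "\<lambda>k. if k \<le> i then c k else 0"
    have "(\<Sum>k<Suc i. c k *s u k) = (\<Sum>k\<le>d. ?c k *s u k)"
      using that by (intro sum.mono_neutral_cong_left) auto
    with c have v_eq: "v = (\<Sum>k\<le>d. ?c k *s u k)" by simp
    have "\<forall>k<i. ?c k = 0"
      by (rule E_triangular) (use that v(2) v_eq in auto)
    then have "v = c i *s u i" using c by simp
    then show "v \<in> {c *s u i | c. True}" by blast
  next
    fix v assume "v \<in> {c *s u i | c. True}"
    then show "v \<in> split_space d E Es i"
      using that by (auto simp: split_space_def sum_of_ranges_eq star.sum_of_ranges_eq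
          E_simps star.E_simps E_u Es_u)
  qed
  have As_u_0: "As (u 0) = \<theta>s 0 *s u 0" by (simp add: u_0 star.A_E)
  \<comment> \<open>The vector \<open>?v\<close> lies in the split space of index
    \<open>i - 1\<close>: subtracting \<open>\<theta>s i *s u i\<close> removes the
    \<open>Es\<close> component at \<open>i\<close>, and \<open>As\<close> raises the
    \<open>E\<close> index by at most one. Its \<open>E\<close> component at
    \<open>d - i + 1\<close> is the image of the nonzero last component of \<open>u i\<close>, which
    makes \<open>b\<close> nonzero.\<close>
  have As_u: "\<exists>b. b \<noteq> 0 \<and> As (u i) = \<theta>s i *s u i + b *s u (i - 1)" if i: "1 \<le> i" "i \<le> d" for i
  proof -
    let ?v = "As (u i) - \<theta>s i *s u i"
    have E_As_u: "E h (As (u i)) = (if h = d - i + 1 then E h (As (E (d - i) (u i))) else 0)"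
      if h: "h \<le> d" "d - i < h" for h
    proof -
      have "E h (As (u i)) = (\<Sum>j\<le>d. E h (As (E j (u i))))" by (rule E_As_expand) (rule h)
      also have "\<dots> = (\<Sum>j\<le>d. if j = d - i then E h (As (E j (u i))) else 0)"
      proof (intro sum.cong refl)
        fix j assume "j \<in> {..d}"
        then show "E h (As (E j (u i))) = (if j = d - i then E h (As (E j (u i))) else 0)"
          using h i hessenberg_zero[of h j] E_u[of j i]
          by (cases j "d - i" rule: linorder_cases) (auto simp: E_simps star.A_simps)
      qed
      also have "\<dots> = E h (As (E (d - i) (u i)))" by simp
      finally show ?thesis using hessenberg_zero[of h "d - i"] h by auto
    qed
    have "Es h ?v = 0" if "h \<le> d" "i \<le> h" for h
      using that Es_u[of h i] by (cases "h = i") (auto simp: star.E_simps star.E_A)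
    moreover have "E h ?v = 0" if "h \<le> d" "d - (i - 1) < h" for h
      using that i E_As_u[of h] E_u[of h i] by (auto simp: E_simps)
    ultimately have "?v \<in> split_space d E Es (i - 1)"
      using i by (auto simp: split_space_def sum_of_ranges_eq star.sum_of_ranges_eq)
    then obtain b where b: "?v = b *s u (i - 1)" using split[of "i - 1"] i by auto
    have "E (d - i + 1) ?v \<noteq> 0"
      using i E_As_u[of "d - i + 1"] E_As_nonzero[of "d - i" "u i"] E_u_nonzero[of "d - i" i]
        E_u[of "d - i + 1" i]
      by (simp add: E_simps)
    then have "b \<noteq> 0" using b i by (auto simp: E_simps)
    then show ?thesis using b by (auto simp: algebra_simps)
  qed
  then obtain b where b: "\<And>i. 1 \<le> i \<Longrightarrow> i \<le> d \<Longrightarrow> b i \<noteq> 0 \<and> As (u i) = \<theta>s i *s u i + b i *s u (i - 1)"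
    by metis
  define \<phi> where "\<phi> i = (if 1 \<le> i \<and> i \<le> d then b i else 0)" for i
  have "\<forall>k\<le>d. c k = 0" if "(\<Sum>k\<le>d. c k *s u k) = 0" for c
    using E_triangular[of "d + 1" c] that by (simp add: E_simps)
  moreover have "As (u i) = \<theta>s i *s u i + \<phi> i *s u (i - 1)" if "i \<le> d" for i
    using that b[of i] As_u_0 by (cases "i = 0") (auto simp: \<phi>_def)
  ultimately have "split_basis u \<phi>"
    unfolding split_basis_def using u_zero A_u spans b by (auto simp: \<phi>_def)
  then show ?thesis using split that by blast
qed

end

section \<open>Equivalent forms of \<open>\<beta>\<close>-recurrence\<close>

lemma beta_recurrent_iff:
  "beta_recurrent \<beta> n \<sigma> \<longleftrightarrow>
     (\<forall>i. i + 3 \<le> n \<longrightarrow> \<sigma> i - (\<beta> + 1) * \<sigma> (i + 1) + (\<beta> + 1) * \<sigma> (i + 2) - \<sigma> (i + 3) = 0)"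
  (is "_ \<longleftrightarrow> (\<forall>i. ?Q i)")
proof
  assume *: "beta_recurrent \<beta> n \<sigma>"
  show "\<forall>i. ?Q i"
  proof
    fix i show "?Q i"
      using *[unfolded beta_recurrent_def, rule_format, of "i + 2"]
      by (simp add: numeral_eq_Suc)
  qed
next
  assume *: "\<forall>i. ?Q i"
  show "beta_recurrent \<beta> n \<sigma>" unfolding beta_recurrent_def
  proof (intro allI impI)
    fix i assume "2 \<le> i \<and> i + 1 \<le> n"
    then obtain k where "i = k + 2" "k + 3 \<le> n" by (auto dest!: le_Suc_ex)
    with *[rule_format, of k]
    show "\<sigma> (i - 2) - (\<beta> + 1) * \<sigma> (i - 1) + (\<beta> + 1) * \<sigma> i - \<sigma> (i + 1) = 0"
      by (simp add: numeral_eq_Suc)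
  qed
qed

text \<open>The four-term expression is the difference of two consecutive values of the three-term
  one.\<close>

lemma beta_recurrent_iff_const:
  "beta_recurrent \<beta> n \<sigma> \<longleftrightarrow> (\<exists>\<gamma>. \<forall>i. i + 2 \<le> n \<longrightarrow> \<sigma> i - \<beta> * \<sigma> (i + 1) + \<sigma> (i + 2) = \<gamma>)"
proof
  assume *: "beta_recurrent \<beta> n \<sigma>"
  have "i + 2 \<le> n \<Longrightarrow> \<sigma> i - \<beta> * \<sigma> (i + 1) + \<sigma> (i + 2) = \<sigma> 0 - \<beta> * \<sigma> 1 + \<sigma> 2" for i
  proof (induction i)
    case 0 then show ?case by (simp add: numeral_2_eq_2)
  next
    case (Suc i)
    then have "\<sigma> i - (\<beta> + 1) * \<sigma> (i + 1) + (\<beta> + 1) * \<sigma> (i + 2) - \<sigma> (i + 3) = 0"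
      using * by (simp add: beta_recurrent_iff)
    then have "\<sigma> (i + 1) - \<beta> * \<sigma> (i + 2) + \<sigma> (i + 3) = \<sigma> i - \<beta> * \<sigma> (i + 1) + \<sigma> (i + 2)"
      by (simp add: algebra_simps)
    with Suc show ?case by (simp add: numeral_eq_Suc)
  qed
  then show "\<exists>\<gamma>. \<forall>i. i + 2 \<le> n \<longrightarrow> \<sigma> i - \<beta> * \<sigma> (i + 1) + \<sigma> (i + 2) = \<gamma>" by blast
next
  assume "\<exists>\<gamma>. \<forall>i. i + 2 \<le> n \<longrightarrow> \<sigma> i - \<beta> * \<sigma> (i + 1) + \<sigma> (i + 2) = \<gamma>"
  then obtain \<gamma> where *: "\<And>i. i + 2 \<le> n \<Longrightarrow> \<sigma> i - \<beta> * \<sigma> (i + 1) + \<sigma> (i + 2) = \<gamma>" by blast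
  show "beta_recurrent \<beta> n \<sigma>" unfolding beta_recurrent_iff
  proof (intro allI impI)
    fix i assume "i + 3 \<le> n"
    then have "(\<sigma> i - \<beta> * \<sigma> (i + 1) + \<sigma> (i + 2)) - (\<sigma> (i + 1) - \<beta> * \<sigma> (i + 2) + \<sigma> (i + 3)) = 0"
      using *[of i] *[of "i + 1"] by (simp add: numeral_eq_Suc)
    then show "\<sigma> i - (\<beta> + 1) * \<sigma> (i + 1) + (\<beta> + 1) * \<sigma> (i + 2) - \<sigma> (i + 3) = 0"
      by (simp add: algebra_simps)
  qed
qed

text \<open>Here \<open>q\<close> is the inverse of \<open>\<beta> + 1\<close>. In this shape the
  recurrences emerge from the cubic relation, where \<open>q\<close> is the leading
  coefficient.\<close>

lemma beta_recurrent_iff_ratio: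
  fixes q :: "'a::field"
  assumes "q \<noteq> 0"
  shows "beta_recurrent (1 / q - 1) n \<sigma> \<longleftrightarrow>
    (\<forall>i. i + 3 \<le> n \<longrightarrow> \<sigma> (i + 1) - \<sigma> (i + 2) = q * (\<sigma> i - \<sigma> (i + 3)))"
proof -
  have "(x - (1 / q - 1 + 1) * y + (1 / q - 1 + 1) * z - w = 0) = (y - z = q * (x - w))" for x y z w
    using assms by (simp add: field_simps) (auto simp: algebra_simps)
  then show ?thesis unfolding beta_recurrent_iff by simp
qed

text \<open>Reversal only changes the sign of the four-term expression.\<close>

lemma beta_recurrent_rev:
  assumes "beta_recurrent \<beta> n \<sigma>" shows "beta_recurrent \<beta> n (\<lambda>i. \<sigma> (n - i))"
  unfolding beta_recurrent_iff
proof (intro allI impI)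
  fix i assume i: "i + 3 \<le> n"
  define k where "k = n - i - 3"
  have "n - i = k + 3" "n - (i + 1) = k + 2" "n - (i + 2) = k + 1" "n - (i + 3) = k"
    using i by (auto simp: k_def)
  moreover have "\<sigma> k - (\<beta> + 1) * \<sigma> (k + 1) + (\<beta> + 1) * \<sigma> (k + 2) - \<sigma> (k + 3) = 0"
    using assms i by (simp add: beta_recurrent_iff k_def)
  ultimately show "\<sigma> (n - i) - (\<beta> + 1) * \<sigma> (n - (i + 1)) + (\<beta> + 1) * \<sigma> (n - (i + 2)) - \<sigma> (n - (i + 3)) = 0"
    by (simp add: algebra_simps)
qed

section \<open>Computing in the split basis\<close>

context hessenberg_frame
begin

text \<open>Outside the prescribed indices \<open>t\<close> and \<open>s\<close> are arbitrary:
  wherever such a value occurs, it multiplies the zero vector, since \<open>u i = 0\<close> for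
  \<open>i > d\<close> and \<open>\<phi> 0 = \<phi> (d + 1) = 0\<close>. Later arguments can
  therefore extend both sequences as their recurrences demand.\<close>

lemma split_basis_action:
  assumes "split_basis u \<phi>" and "\<And>i. i \<le> d \<Longrightarrow> t (i + 1) = \<theta> (d - i)"
    and "\<And>i. i \<le> d \<Longrightarrow> s i = \<theta>s i"
  shows "A (u i) = t (i + 1) *s u i + u (i + 1)"
    and "As (u i) = s i *s u i + \<phi> i *s u (i - 1)"
    and "A (\<phi> i *s u (i - 1)) = t i *s \<phi> i *s u (i - 1) + \<phi> i *s u i"
proof -
  have u: "\<And>i. d < i \<Longrightarrow> u i = 0" and \<phi>: "\<phi> 0 = 0" "\<phi> (d + 1) = 0"
    and Au: "\<And>i. i \<le> d \<Longrightarrow> A (u i) = \<theta> (d - i) *s u i + u (i + 1)"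
    and Asu: "\<And>i. i \<le> d \<Longrightarrow> As (u i) = \<theta>s i *s u i + \<phi> i *s u (i - 1)"
    using assms(1) by (auto simp: split_basis_def)
  show Au': "A (u i) = t (i + 1) *s u i + u (i + 1)" for i
    using Au[of i] assms(2)[of i] u by (cases "i \<le> d") (auto simp: A_simps)
  have "\<phi> i *s u (i - 1) = 0" if "d < i"
    using that u[of "i - 1"] \<phi> by (cases "i = d + 1") auto
  then show "As (u i) = s i *s u i + \<phi> i *s u (i - 1)"
    using Asu[of i] assms(3)[of i] u by (cases "i \<le> d") (auto simp: star.A_simps)
  show "A (\<phi> i *s u (i - 1)) = t i *s \<phi> i *s u (i - 1) + \<phi> i *s u i"
    using \<phi> Au'[of "i - 1"] by (cases i) (auto simp: A_simps algebra_simps)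
qed

lemma split_basis_induct:
  assumes "split_basis u \<phi>" and "\<And>k. k \<le> d \<Longrightarrow> P (u k)"
    and "\<And>x y. P x \<Longrightarrow> P y \<Longrightarrow> P (x + y)" and "\<And>c x. P x \<Longrightarrow> P (c *s x)"
  shows "P v"
proof -
  obtain c where v: "v = (\<Sum>k\<le>d. c k *s u k)"
    using assms(1) unfolding split_basis_def by blast
  have "n \<le> d \<Longrightarrow> P (\<Sum>k\<le>n. c k *s u k)" for n
    by (induction n) (use assms(2-4) in auto)
  then show ?thesis using v by simp
qed

text \<open>The dual basis, used to extract single coefficients from vector identities. For
  \<open>j > d\<close> the last property holds because \<open>u j = 0\<close>.\<close>

lemma split_basis_coordinates:
  assumes "split_basis u \<phi>"
  obtains f :: "nat \<Rightarrow> 'v \<Rightarrow> 'f"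
  where "\<And>k x y. k \<le> d \<Longrightarrow> f k (x + y) = f k x + f k y"
    and "\<And>k x y. k \<le> d \<Longrightarrow> f k (x - y) = f k x - f k y"
    and "\<And>k c x. k \<le> d \<Longrightarrow> f k (c *s x) = c * f k x"
    and "\<And>k j. k \<le> d \<Longrightarrow> f k (u j) = (if j = k then 1 else 0)"
proof -
  have "\<forall>v. \<exists>c. v = (\<Sum>k\<le>d. c k *s u k)"
    and indep: "\<And>c. (\<Sum>k\<le>d. c k *s u k) = 0 \<Longrightarrow> \<forall>k\<le>d. c k = 0"
    using assms by (simp_all add: split_basis_def)
  then obtain g where g: "\<And>v. v = (\<Sum>k\<le>d. g v k *s u k)" by metis
  have unique: "g v k = c k" if "v = (\<Sum>k\<le>d. c k *s u k)" "k \<le> d" for v c k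
  proof -
    have "(\<Sum>k\<le>d. g v k *s u k) = (\<Sum>k\<le>d. c k *s u k)" using that(1) by (simp add: g[symmetric])
    then have "(\<Sum>k\<le>d. (g v k - c k) *s u k) = 0"
      by (simp add: scale_left_diff_distrib sum_subtractf)
    from indep[OF this] show ?thesis using that(2) by simp
  qed
  show ?thesis
  proof (rule that[of "\<lambda>k v. g v k"])
    fix k x y assume k: "k \<le> d"
    have "x + y = (\<Sum>k\<le>d. (g x k + g y k) *s u k)"
      by (simp add: scale_left_distrib sum.distrib g[symmetric])
    then show "g (x + y) k = g x k + g y k" using k by (rule unique)
    have "x - y = (\<Sum>k\<le>d. (g x k - g y k) *s u k)"
      by (simp add: scale_left_diff_distrib sum_subtractf g[symmetric])
    then show "g (x - y) k = g x k - g y k" using k by (rule unique)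
  next
    fix k c x assume k: "k \<le> d"
    have "c *s x = (\<Sum>k\<le>d. (c * g x k) *s u k)"
      by (simp only: scale_scale[symmetric] scale_sum_right[symmetric] g[symmetric])
    then show "g (c *s x) k = c * g x k" using k by (rule unique)
  next
    fix k j assume k: "k \<le> d"
    have "u j = (\<Sum>k\<le>d. (if j = k then 1 else 0) *s u k)"
      using assms by (cases "j \<le> d") (auto simp: split_basis_def if_distrib if_distribR cong: if_cong)
    then show "g (u j) k = (if j = k then 1 else 0)" using k by (rule unique)
  qed
qed

text \<open>Under \<open>E h\<close> the map \<open>A\<close> becomes the scalar
  \<open>\<theta> h\<close>, so each step of the recursion for \<open>u\<close> contributes one
  factor. If \<open>E h (u 0)\<close> were zero, \<open>E h\<close> would vanish on the
  basis.\<close>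

lemma E_split_basis:
  assumes "split_basis u \<phi>" and "h \<le> d"
  shows "k \<le> d \<Longrightarrow> E h (u k) = (\<Prod>j<k. \<theta> h - \<theta> (d - j)) *s E h (u 0)"
    and "E h (u 0) \<noteq> 0"
proof -
  have Au: "\<And>i. i \<le> d \<Longrightarrow> u (Suc i) = A (u i) - \<theta> (d - i) *s u i"
    using assms(1) by (auto simp: split_basis_def)
  show *: "k \<le> d \<Longrightarrow> E h (u k) = (\<Prod>j<k. \<theta> h - \<theta> (d - j)) *s E h (u 0)" for k
    by (induction k) (simp_all add: assms(2) E_simps E_A Au algebra_simps)
  show "E h (u 0) \<noteq> 0"
  proof
    assume "E h (u 0) = 0"
    then have "E h (u k) = 0" if "k \<le> d" for k using *[OF that] by simp
    then have "E h v = 0" for v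
      by (induction v rule: split_basis_induct[OF assms(1)]) (simp_all add: E_simps assms(2))
    then show False using E_nonzero assms(2) by blast
  qed
qed

text \<open>Only the entries \<open>m 0\<close>, \<open>m 1\<close>, \<open>m d\<close> of row 0 of
  \<open>As\<close> are left. The vectors \<open>u 0\<close>, \<open>u 1\<close>, \<open>u d\<close>
  give three linear equations for them, and the difference of the two sides comes out as
  \<open>m d * (\<theta> d - \<theta> 1)\<close>.\<close>

lemma corner_zero_iff:
  assumes sb: "split_basis u \<phi>" and "d \<ge> 2"
    and row: "\<And>j v. 2 \<le> j \<Longrightarrow> j < d \<Longrightarrow> E 0 (As (E j v)) = 0"
  shows "\<phi> 1 - (\<theta>s 1 - \<theta>s 0) * (\<theta> d - \<theta> 0) = \<phi> d - (\<theta>s d - \<theta>s 0) * (\<theta> 1 - \<theta> 0)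
    \<longleftrightarrow> (\<forall>v. E 0 (As (E d v)) = 0)"
proof -
  let ?e = "E 0 (u 0)" and ?\<eta> = "\<lambda>k x. \<Prod>j<k. x - \<theta> (d - j)"
  have e: "?e \<noteq> 0" by (rule E_split_basis(2)[OF sb]) simp
  have "\<exists>m. E 0 (As (E j (u 0))) = m *s ?e" for j using E_rank[of 0 "u 0"] e by simp
  then obtain m where m: "\<And>j. E 0 (As (E j (u 0))) = m j *s ?e" by metis
  have Asu: "As (u k) = \<theta>s k *s u k + \<phi> k *s u (k - 1)" if "k \<le> d" for k
    using sb that by (auto simp: split_basis_def)
  \<comment> \<open>The vector \<open>E 0 (As (u k))\<close> is computed twice: by inserting the sum
    of the \<open>E j\<close>, and from the bidiagonal action of \<open>As\<close>.\<close>
  have main: "?\<eta> k (\<theta> 0) * m 0 + ?\<eta> k (\<theta> 1) * m 1 + ?\<eta> k (\<theta> d) * m d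
      = \<theta>s k * ?\<eta> k (\<theta> 0) + \<phi> k * ?\<eta> (k - 1) (\<theta> 0)" if k: "k \<le> d" for k
  proof -
    have tm: "E 0 (As (E j (u k))) = (?\<eta> k (\<theta> j) * m j) *s ?e" if "j \<le> d" for j
      using E_split_basis(1)[OF sb that k] by (simp add: E_simps star.A_simps m)
    have "E 0 (As (u k)) = (\<Sum>j\<le>d. E 0 (As (E j (u k))))" by (rule E_As_expand) simp
    also have "\<dots> = (\<Sum>j\<in>{0, 1, d}. E 0 (As (E j (u k))))"
    proof (intro sum.mono_neutral_right ballI)
      fix j assume "j \<in> {..d} - {0, 1, d}"
      then have "2 \<le> j" "j < d" by auto
      then show "E 0 (As (E j (u k))) = 0" by (rule row)
    qed (use \<open>d \<ge> 2\<close> in auto)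
    also have "\<dots> = (?\<eta> k (\<theta> 0) * m 0 + ?\<eta> k (\<theta> 1) * m 1 + ?\<eta> k (\<theta> d) * m d) *s ?e"
      using \<open>d \<ge> 2\<close> by (simp add: tm algebra_simps)
    finally have "E 0 (As (u k)) = \<dots>" .
    moreover have "E 0 (As (u k)) = (\<theta>s k * ?\<eta> k (\<theta> 0) + \<phi> k * ?\<eta> (k - 1) (\<theta> 0)) *s ?e"
      using E_split_basis(1)[OF sb, of 0 k] E_split_basis(1)[OF sb, of 0 "k - 1"] k
      by (simp add: Asu E_simps algebra_simps)
    ultimately show ?thesis using e by simp
  qed
  have m0: "m 0 + m 1 + m d = \<theta>s 0" using main[of 0] sb by (simp add: split_basis_def)
  have m1: "(\<theta> 0 - \<theta> d) * m 0 + (\<theta> 1 - \<theta> d) * m 1 = \<theta>s 1 * (\<theta> 0 - \<theta> d) + \<phi> 1"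
    using main[of 1] \<open>d \<ge> 2\<close> by simp
  have md: "(\<theta> 0 - \<theta> 1) * m 0 = \<theta>s d * (\<theta> 0 - \<theta> 1) + \<phi> d"
  proof -
    obtain k where k: "d = Suc k" using \<open>d \<ge> 2\<close> by (cases d) auto
    \<comment> \<open>At \<open>k = d\<close> the products for \<open>\<theta> 1\<close> and
      \<open>\<theta> d\<close> contain a zero factor, so the equation determines \<open>m 0\<close>
      alone.\<close>
    have z1: "?\<eta> d (\<theta> 1) = 0"
      using \<open>d \<ge> 2\<close> by (intro prod_zero bexI[of _ "d - 1"]) auto
    have zd: "?\<eta> d (\<theta> d) = 0"
      using \<open>d \<ge> 2\<close> by (intro prod_zero bexI[of _ 0]) auto
    have \<eta>d: "?\<eta> d (\<theta> 0) = ?\<eta> (d - 1) (\<theta> 0) * (\<theta> 0 - \<theta> 1)" using k by simp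
    have "?\<eta> (d - 1) (\<theta> 0) * ((\<theta> 0 - \<theta> 1) * m 0) =
        ?\<eta> (d - 1) (\<theta> 0) * (\<theta>s d * (\<theta> 0 - \<theta> 1) + \<phi> d)"
      using main[OF order_refl, unfolded z1 zd \<eta>d] by (simp only: algebra_simps mult_zero_left add_0_left)
    moreover have "?\<eta> (d - 1) (\<theta> 0) \<noteq> 0" using \<open>d \<ge> 2\<close> by (auto simp: \<theta>_eq_iff)
    ultimately show ?thesis by simp
  qed
  have p1: "\<phi> 1 = (\<theta> 0 - \<theta> d) * m 0 + (\<theta> 1 - \<theta> d) * m 1 - \<theta>s 1 * (\<theta> 0 - \<theta> d)" and
    pd: "\<phi> d = (\<theta> 0 - \<theta> 1) * m 0 - \<theta>s d * (\<theta> 0 - \<theta> 1)"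
    using m1 md by (simp_all add: algebra_simps)
  have "(\<phi> 1 - (\<theta>s 1 - \<theta>s 0) * (\<theta> d - \<theta> 0)) - (\<phi> d - (\<theta>s d - \<theta>s 0) * (\<theta> 1 - \<theta> 0)) = m d * (\<theta> d - \<theta> 1)"
    unfolding p1 pd m0[symmetric] by (simp add: algebra_simps)
  moreover have "\<theta> d \<noteq> \<theta> 1" using \<open>d \<ge> 2\<close> by (simp add: \<theta>_eq_iff)
  ultimately have "\<phi> 1 - (\<theta>s 1 - \<theta>s 0) * (\<theta> d - \<theta> 0) = \<phi> d - (\<theta>s d - \<theta>s 0) * (\<theta> 1 - \<theta> 0) \<longleftrightarrow> m d = 0"
    by (metis eq_iff_diff_eq_0 mult_eq_0_iff)
  also have "\<dots> \<longleftrightarrow> (\<forall>v. E 0 (As (E d v)) = 0)"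
  proof
    assume 0: "m d = 0"
    show "\<forall>v. E 0 (As (E d v)) = 0"
    proof
      fix v
      obtain c where "E d v = c *s E d (u 0)" using E_rank[of d "u 0" v] E_split_basis(2)[OF sb, of d] by auto
      then show "E 0 (As (E d v)) = 0" using m[of d] 0 by (simp add: E_simps star.A_simps)
    qed
  next
    assume "\<forall>v. E 0 (As (E d v)) = 0"
    then show "m d = 0" using m[of d] e by auto
  qed
  finally show ?thesis .
qed

end

section \<open>From the recurrences to tridiagonality\<close>

lemma three_term_quadratic_const:
  fixes \<sigma> :: "nat \<Rightarrow> 'a::field"
  assumes rec: "\<And>i. i + 2 \<le> n \<Longrightarrow> \<sigma> i - \<beta> * \<sigma> (i + 1) + \<sigma> (i + 2) = \<gamma>"
  defines "P \<equiv> \<lambda>x y. x * x - \<beta> * x * y + y * y - \<gamma> * (x + y)"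
  shows "i < n \<Longrightarrow> P (\<sigma> i) (\<sigma> (i + 1)) = P (\<sigma> 0) (\<sigma> 1)"
proof (induction i)
  case (Suc i)
  \<comment> \<open>For fixed \<open>y = \<sigma> (i + 1)\<close> the equation
    \<open>P x y = const\<close> is quadratic in \<open>x\<close> with root sum
    \<open>\<gamma> + \<beta> * y\<close>. Hence \<open>\<sigma> i\<close> and
    \<open>\<sigma> (i + 2)\<close> are its two roots, and \<open>P\<close> is symmetric.\<close>
  have eq: "\<sigma> (i + 2) = \<gamma> + \<beta> * \<sigma> (i + 1) - \<sigma> i"
    using rec[of i] Suc.prems by (simp add: algebra_simps)
  have "P (\<sigma> (i + 1)) (\<sigma> (i + 2)) = P (\<sigma> i) (\<sigma> (i + 1))"
    unfolding P_def eq by (simp add: algebra_simps)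
  then show ?case using Suc by simp
qed simp

context hessenberg_frame
begin

text \<open>On \<open>u i\<close> both sides are combinations of \<open>u (i - 1)\<close> up to
  \<open>u (i + 2)\<close>, so four coefficients have to match: the outer two by the quadratic
  invariant of \<open>\<theta>\<close> and the recurrence of \<open>\<theta>s\<close>, the inner two
  by a suitable choice of \<open>w\<close> and \<open>n\<close>.\<close>

lemma askey_wilson_relation:
  fixes \<phi> \<eta> :: "nat \<Rightarrow> 'f"
  assumes sb: "split_basis u \<phi>" and d: "2 \<le> d"
    and \<theta>_rec: "\<And>i. i + 2 \<le> d \<Longrightarrow> \<theta> i - \<beta> * \<theta> (i + 1) + \<theta> (i + 2) = \<gamma>"
    and \<theta>s_rec: "\<And>i. i + 2 \<le> d \<Longrightarrow> \<theta>s i - \<beta> * \<theta>s (i + 1) + \<theta>s (i + 2) = \<gamma>s"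
    and \<eta>_rec: "\<And>i. i + 2 \<le> d + 1 \<Longrightarrow> \<eta> i - \<beta> * \<eta> (i + 1) + \<eta> (i + 2) = \<omega>"
    and \<rho>: "\<theta> 0 * \<theta> 0 - \<beta> * \<theta> 0 * \<theta> 1 + \<theta> 1 * \<theta> 1 - \<gamma> * (\<theta> 0 + \<theta> 1) = \<rho>"
    and \<eta>: "\<eta> 0 = 0" "\<eta> (d + 1) = 0"
      "\<And>i. 1 \<le> i \<Longrightarrow> i \<le> d \<Longrightarrow> \<eta> i = \<phi> i - (\<theta>s i - \<theta>s 0) * (\<theta> (d - i + 1) - \<theta> 0)"
  shows "\<exists>w n. \<forall>v. A (A (As v)) - \<beta> *s A (As (A v)) + As (A (A v)) - \<gamma> *s (A (As v) + As (A v))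
    - \<rho> *s As v = \<gamma>s *s A (A v) + w *s A v + n *s v"
proof -
  \<comment> \<open>\<open>t\<close> is the reversed sequence \<open>\<theta>\<close> with index shifted by one; both \<open>t\<close> and \<open>s\<close> are continued
    past the ends by their recurrences, so that the coefficient identities need no boundary cases.\<close>
  define t where "t i = (if i = 0 then \<gamma> + \<beta> * \<theta> d - \<theta> (d - 1)
    else if i \<le> d + 1 then \<theta> (d + 1 - i) else \<gamma> + \<beta> * \<theta> 0 - \<theta> 1)" for i
  define s where "s i = (if i \<le> d then \<theta>s i else \<gamma>s + \<beta> * \<theta>s d - \<theta>s (d - 1))" for i
  have \<phi>0: "\<phi> 0 = 0" and \<phi>d: "\<phi> (d + 1) = 0" and u_zero: "\<And>i. d < i \<Longrightarrow> u i = 0"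
    using sb by (auto simp: split_basis_def)
  have t_rec: "t (i + 2) = \<gamma> + \<beta> * t (i + 1) - t i" if "i \<le> d" for i
  proof -
    consider "i = 0" | "i = d" | "1 \<le> i" "i < d" using \<open>i \<le> d\<close> by linarith
    then show ?thesis
    proof cases
      case 1 then show ?thesis using d by (simp add: t_def)
    next
      case 2 then show ?thesis using d by (simp add: t_def)
    next
      case 3
      define k where "k = d - 1 - i"
      have "d + 1 - i = k + 2" "d + 1 - (i + 1) = k + 1" "d + 1 - (i + 2) = k" "k + 2 \<le> d"
        using 3 by (auto simp: k_def)
      then have "t i = \<theta> (k + 2)" "t (i + 1) = \<theta> (k + 1)" "t (i + 2) = \<theta> k"
        using 3 by (auto simp: t_def)
      then show ?thesis using \<theta>_rec[OF \<open>k + 2 \<le> d\<close>] by (simp add: algebra_simps)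
    qed
  qed
  have s_rec: "s (i + 2) = \<gamma>s + \<beta> * s (i + 1) - s i" if "i < d" for i
  proof (cases "i + 2 \<le> d")
    case True then show ?thesis using \<theta>s_rec[of i] by (simp add: s_def algebra_simps)
  next
    case False
    then have "i + 1 = d" using that by simp
    then show ?thesis by (auto simp: s_def)
  qed
  have \<eta>_rec': "\<eta> i - \<beta> * \<eta> (i + 1) + \<eta> (i + 2) = \<omega>" if "i < d" for i
    using \<eta>_rec[of i] that by simp
  \<comment> \<open>At \<open>i = 0\<close> and \<open>i = d + 1\<close> one of the two factors is
    zero, in agreement with the zero boundary values of \<open>\<phi>\<close> and
    \<open>\<eta>\<close>.\<close>
  have \<phi>: "\<phi> i = \<eta> i + (s i - s 0) * (t i - t (d + 1))" if i: "i \<le> d + 1" for i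
  proof -
    consider "i = 0" | "i = d + 1" | "1 \<le> i" "i \<le> d" using i by linarith
    then show ?thesis
    proof cases
      case 3
      then have "d + 1 - i = d - i + 1" by simp
      then show ?thesis using \<eta>(3)[of i] 3 by (simp add: s_def t_def)
    qed (use \<phi>0 \<phi>d \<eta> in auto)
  qed
  \<comment> \<open>The invariant is known at the end \<open>i = d\<close>, where it involves
    \<open>\<theta> 1\<close> and \<open>\<theta> 0\<close>, and is carried from there to all other
    indices.\<close>
  have t_quad: "t i * t i - \<beta> * t i * t (i + 1) + t (i + 1) * t (i + 1) - \<gamma> * (t i + t (i + 1)) = \<rho>"
    if "i \<le> d" for i
  proof -
    have *: "t i * t i - \<beta> * t i * t (i + 1) + t (i + 1) * t (i + 1) - \<gamma> * (t i + t (i + 1))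
      = t 0 * t 0 - \<beta> * t 0 * t 1 + t 1 * t 1 - \<gamma> * (t 0 + t 1)" if "i < d + 2" for i
      by (rule three_term_quadratic_const[of "d + 2"]) (use t_rec that in \<open>simp_all add: algebra_simps\<close>)
    have "t d = \<theta> 1" "t (d + 1) = \<theta> 0" using d by (simp_all add: t_def)
    then have "t d * t d - \<beta> * t d * t (d + 1) + t (d + 1) * t (d + 1) - \<gamma> * (t d + t (d + 1)) = \<rho>"
      using \<rho> by (simp add: algebra_simps)
    then show ?thesis using *[of i] *[of d] that by simp
  qed
  define p where "p i = \<phi> i *s u (i - 1)" for i
  have actions: "A (u i) = t (i + 1) *s u i + u (i + 1)" "As (u i) = s i *s u i + p i"
    "A (p i) = t i *s p i + \<phi> i *s u i" for i
    unfolding p_def by (rule split_basis_action[OF sb, of t s]; simp add: t_def s_def)+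
  have p_Suc: "p (i + 1) = \<phi> (i + 1) *s u i" "p (i + 2) = \<phi> (i + 2) *s u (i + 1)" for i
    by (simp_all add: p_def)
  \<comment> \<open>When the left side is applied to \<open>u i\<close>, \<open>x i\<close> and
    \<open>y i\<close> are the coefficients of \<open>u (i + 1)\<close> and \<open>u i\<close>; the
    part along \<open>u (i - 1)\<close> is carried by \<open>p i\<close>.\<close>
  define x where "x i = \<phi> i - \<beta> * \<phi> (i + 1) + \<phi> (i + 2) + (s i + s (i + 1)) * (t (i + 1) + t (i + 2))
    - \<beta> * (t (i + 1) * s i + s (i + 1) * t (i + 2)) - \<gamma> * (s i + s (i + 1))" for i
  define y where "y i = \<phi> i * (t i + t (i + 1)) + s i * t (i + 1) * t (i + 1)
    - \<beta> * (s i * t (i + 1) * t (i + 1) + \<phi> i * t (i + 1) + \<phi> (i + 1) * t (i + 1))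
    + (s i * t (i + 1) * t (i + 1) + \<phi> (i + 1) * (t (i + 1) + t (i + 2)))
    - \<gamma> * (s i * t (i + 1) + \<phi> i + s i * t (i + 1) + \<phi> (i + 1)) - \<rho> * s i" for i
  have X_u: "A (A (As (u i))) - \<beta> *s A (As (A (u i))) + As (A (A (u i)))
      - \<gamma> *s (A (As (u i)) + As (A (u i))) - \<rho> *s As (u i)
    = (t i * t i - \<beta> * t i * t (i + 1) + t (i + 1) * t (i + 1) - \<gamma> * (t i + t (i + 1)) - \<rho>) *s p i
      + y i *s u i + x i *s u (i + 1) + (s i - \<beta> * s (i + 1) + s (i + 2)) *s u (i + 2)" for i
    unfolding x_def y_def Suc_eq_plus1[symmetric] add_2_eq_Suc'
    by (simp only: actions[unfolded Suc_eq_plus1[symmetric]]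
        p_Suc[unfolded Suc_eq_plus1[symmetric] add_2_eq_Suc'] A_simps star.A_simps scale_scale algebra_simps)
  have AA_u: "A (A (u i)) = (t (i + 1) * t (i + 1)) *s u i + (t (i + 1) + t (i + 2)) *s u (i + 1) + u (i + 2)" for i
    by (simp add: actions A_simps algebra_simps)
  \<comment> \<open>\<open>K\<close> is the part of \<open>x i\<close> not absorbed by the
    recurrence of \<open>\<eta>\<close>; the recurrences of \<open>s\<close> and \<open>t\<close>
    together keep it constant.\<close>
  define K where "K i = s i * (t (i + 1) - t (i + 2)) + s (i + 1) * (t (i + 1) - t i) - \<gamma>s * t (i + 1)" for i
  have K: "i < d \<Longrightarrow> K i = K 0" for i
  proof (induction i)
    case (Suc i)
    have t0: "t i = \<gamma> + \<beta> * t (i + 1) - t (i + 2)" and t3: "t (i + 3) = \<gamma> + \<beta> * t (i + 2) - t (i + 1)"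
      using t_rec[of i] t_rec[of "i + 1"] Suc.prems by (simp_all add: numeral_eq_Suc)
    have s2: "s (i + 2) = \<gamma>s + \<beta> * s (i + 1) - s i" using s_rec[of i] Suc.prems by simp
    have "K (i + 1) = s (i + 1) * (t (i + 2) - t (i + 3)) + s (i + 2) * (t (i + 2) - t (i + 1)) - \<gamma>s * t (i + 2)"
      by (simp add: K_def numeral_eq_Suc)
    also have "\<dots> = K i" unfolding K_def t0 t3 s2 by (simp add: algebra_simps)
    finally show ?case using Suc by simp
  qed simp
  define w where "w = \<omega> - s 0 * \<gamma> - t (d + 1) * \<gamma>s + (2 - \<beta>) * s 0 * t (d + 1) + K 0"
  have x: "x i = \<gamma>s * (t (i + 1) + t (i + 2)) + w" if "i < d" for i
  proof -
    have t0: "t i = \<gamma> + \<beta> * t (i + 1) - t (i + 2)" using t_rec[of i] that by simp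
    have \<phi>': "\<phi> i = \<eta> i + (s i - s 0) * (t i - t (d + 1))"
      "\<phi> (i + 1) = \<eta> (i + 1) + (s (i + 1) - s 0) * (t (i + 1) - t (d + 1))"
      "\<phi> (i + 2) = \<eta> (i + 2) + (s (i + 2) - s 0) * (t (i + 2) - t (d + 1))"
      using that by (simp_all only: \<phi>)
    have "x i - \<gamma>s * (t (i + 1) + t (i + 2)) = (\<eta> i - \<beta> * \<eta> (i + 1) + \<eta> (i + 2))
        - s 0 * \<gamma> - t (d + 1) * \<gamma>s + (2 - \<beta>) * s 0 * t (d + 1) + K i"
      unfolding x_def K_def \<phi>' s_rec[OF that] t0 by (simp add: algebra_simps)
    also have "\<dots> = w" by (simp only: \<eta>_rec'[OF that] K[OF that] w_def)
    finally show ?thesis by (simp add: algebra_simps)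
  qed
  \<comment> \<open>The case \<open>i = 0\<close> forces this value. For larger \<open>i\<close> the
    increments of \<open>y\<close> are \<open>(t (i + 2) - t (i + 1)) * x i\<close>, so they
    telescope once \<open>x\<close> is known.\<close>
  define n where "n = y 0 - \<gamma>s * t 1 * t 1 - w * t 1"
  have y: "i \<le> d \<Longrightarrow> y i = \<gamma>s * t (i + 1) * t (i + 1) + w * t (i + 1) + n" for i
  proof (induction i)
    case 0 then show ?case by (simp add: n_def)
  next
    case (Suc i)
    have t0: "t i = \<gamma> + \<beta> * t (i + 1) - t (i + 2)" and t3: "t (i + 1 + 2) = \<gamma> + \<beta> * t (i + 1 + 1) - t (i + 1)"
      using t_rec[of i] t_rec[of "i + 1"] Suc.prems by simp_all
    have \<rho>': "\<rho> = t (i + 1) * t (i + 1) - \<beta> * t (i + 1) * t (i + 2) + t (i + 2) * t (i + 2) - \<gamma> * (t (i + 1) + t (i + 2))"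
      using t_quad[of "i + 1"] Suc.prems by simp
    have "y (i + 1) - y i = (t (i + 2) - t (i + 1)) * x i"
      unfolding y_def x_def \<rho>' t3 t0 by (simp add: algebra_simps)
    then have "y (i + 1) = y i + (t (i + 2) - t (i + 1)) * (\<gamma>s * (t (i + 1) + t (i + 2)) + w)"
      using x[of i] Suc.prems by (simp add: algebra_simps)
    also have "\<dots> = \<gamma>s * t (i + 2) * t (i + 2) + w * t (i + 2) + n"
      using Suc by (simp add: algebra_simps)
    finally show ?case by simp
  qed
  have "A (A (As v)) - \<beta> *s A (As (A v)) + As (A (A v)) - \<gamma> *s (A (As v) + As (A v))
    - \<rho> *s As v = \<gamma>s *s A (A v) + w *s A v + n *s v" (is "?L v = ?R v") for v
  proof (induction v rule: split_basis_induct[OF sb])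
    case (1 i)
    \<comment> \<open>The formulas for \<open>x\<close> and \<open>s\<close> are available only for
      \<open>i < d\<close>; at \<open>i = d\<close> the vectors they multiply are zero.\<close>
    have x_u: "x i *s u (i + 1) = (\<gamma>s * (t (i + 1) + t (i + 2)) + w) *s u (i + 1)"
      using x[of i] u_zero[of "i + 1"] by (cases "i < d") auto
    have s_u: "(s i - \<beta> * s (i + 1) + s (i + 2)) *s u (i + 2) = \<gamma>s *s u (i + 2)"
      using s_rec[of i] u_zero[of "i + 2"] by (cases "i < d") auto
    have t_u: "t i * t i - \<beta> * t i * t (i + 1) + t (i + 1) * t (i + 1) - \<gamma> * (t i + t (i + 1)) - \<rho> = 0"
      using t_quad[OF 1] by simp
    have "?L (u i) = y i *s u i + (\<gamma>s * (t (i + 1) + t (i + 2)) + w) *s u (i + 1) + \<gamma>s *s u (i + 2)"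
      unfolding X_u x_u s_u t_u by simp
    also have "\<dots> = ?R (u i)"
      unfolding y[OF 1] AA_u by (simp add: actions algebra_simps)
    finally show ?case .
  next
    case (2 v v')
    have "?L (v + v') = ?L v + ?L v'" by (simp add: A_simps star.A_simps algebra_simps)
    also have "\<dots> = ?R (v + v')" unfolding 2 by (simp add: A_simps algebra_simps)
    finally show ?case .
  next
    case (3 c v)
    have "?L (c *s v) = c *s ?L v" by (simp add: A_simps star.A_simps algebra_simps)
    also have "\<dots> = ?R (c *s v)" unfolding 3 by (simp add: A_simps algebra_simps)
    finally show ?case .
  qed
  then show ?thesis by blast
qed

lemma recurrent_imp_tridiagonal:
  fixes \<eta> :: "nat \<Rightarrow> 'f"
  assumes sb: "split_basis u \<phi>" and d: "3 \<le> d"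
    and \<eta>: "\<eta> 0 = 0" "\<eta> (d + 1) = 0"
      "\<And>i. 1 \<le> i \<Longrightarrow> i \<le> d \<Longrightarrow> \<eta> i = \<phi> i - (\<theta>s i - \<theta>s 0) * (\<theta> (d - i + 1) - \<theta> 0)"
    and eq: "\<eta> 1 = \<eta> d"
    and rec: "beta_recurrent \<beta> d \<theta>" "beta_recurrent \<beta> d \<theta>s" "beta_recurrent \<beta> (d + 1) \<eta>"
    and ij: "i + 1 < j" "j \<le> d"
  shows "E i (As (E j v)) = 0"
proof -
  obtain \<gamma> where \<gamma>: "\<And>i. i + 2 \<le> d \<Longrightarrow> \<theta> i - \<beta> * \<theta> (i + 1) + \<theta> (i + 2) = \<gamma>"
    using rec(1) unfolding beta_recurrent_iff_const by blast
  obtain \<gamma>s where \<gamma>s: "\<And>i. i + 2 \<le> d \<Longrightarrow> \<theta>s i - \<beta> * \<theta>s (i + 1) + \<theta>s (i + 2) = \<gamma>s"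
    using rec(2) unfolding beta_recurrent_iff_const by blast
  obtain \<omega> where \<omega>: "\<And>i. i + 2 \<le> d + 1 \<Longrightarrow> \<eta> i - \<beta> * \<eta> (i + 1) + \<eta> (i + 2) = \<omega>"
    using rec(3) unfolding beta_recurrent_iff_const by blast
  define P where "P x y = x * x - \<beta> * x * y + y * y - \<gamma> * (x + y)" for x y
  define \<rho> where "\<rho> = P (\<theta> 0) (\<theta> 1)"
  have P_next: "P (\<theta> i) (\<theta> (i + 1)) = \<rho>" if "i < d" for i
    unfolding \<rho>_def P_def by (rule three_term_quadratic_const[OF \<gamma> that])
  \<comment> \<open>The two neighbours of \<open>\<theta> (i + 1)\<close> are the roots of this
    quadratic, which therefore vanishes at no other eigenvalue.\<close>
  have P_factor: "P (\<theta> (i + 1)) y - \<rho> = (y - \<theta> i) * (y - \<theta> (i + 2))" if "i + 2 \<le> d" for i y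
  proof -
    have \<theta>2: "\<theta> (i + 2) = \<gamma> + \<beta> * \<theta> (i + 1) - \<theta> i" using \<gamma>[OF that] by (simp add: algebra_simps)
    have \<rho>': "\<rho> = P (\<theta> i) (\<theta> (i + 1))" using P_next[of i] that by simp
    show ?thesis unfolding \<rho>' P_def \<theta>2 by (simp add: algebra_simps)
  qed
  obtain w n where AW: "\<And>v. A (A (As v)) - \<beta> *s A (As (A v)) + As (A (A v)) - \<gamma> *s (A (As v) + As (A v))
    - \<rho> *s As v = \<gamma>s *s A (A v) + w *s A v + n *s v"
    using askey_wilson_relation[OF sb _ \<gamma> \<gamma>s \<omega> _ \<eta>, of \<rho>] d by (auto simp: \<rho>_def P_def)
  \<comment> \<open>The right side of the relation is a polynomial in \<open>A\<close>, so it
    disappears between two different idempotents.\<close>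
  have P_zero: "(P (\<theta> i) (\<theta> j) - \<rho>) *s E i (As (E j v)) = 0" if "i \<le> d" "j \<le> d" "i \<noteq> j" for i j v
  proof -
    have "E i (A (A (As (E j v))) - \<beta> *s A (As (A (E j v))) + As (A (A (E j v)))
      - \<gamma> *s (A (As (E j v)) + As (A (E j v))) - \<rho> *s As (E j v)) = 0"
      unfolding AW using that by (simp add: A_E E_simps A_simps E_E)
    then show ?thesis using that
      by (simp add: P_def E_simps star.A_simps A_simps E_A A_E algebra_simps)
  qed
  \<comment> \<open>The factorization is applied at whichever of \<open>i\<close>, \<open>j\<close>
    has neighbours on both sides. Only \<open>(0, d)\<close> offers no such index.\<close>
  have interior: "E i (As (E j v)) = 0" if ij: "i + 1 < j" "j \<le> d" "0 < i \<or> j < d" for i j v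
  proof -
    have "P (\<theta> i) (\<theta> j) - \<rho> \<noteq> 0"
    proof (cases "0 < i")
      case True
      then obtain k where "i = k + 1" by (metis Suc_eq_plus1 gr0_implies_Suc)
      then show ?thesis using P_factor[of k "\<theta> j"] ij by (simp add: \<theta>_eq_iff)
    next
      case False
      then obtain k where "j = k + 1" using ij by (metis Suc_eq_plus1 gr0_implies_Suc not_less0 not_gr_zero)
      moreover have "P (\<theta> i) (\<theta> j) = P (\<theta> j) (\<theta> i)" by (simp add: P_def algebra_simps)
      ultimately show ?thesis using P_factor[of k "\<theta> i"] ij False by (simp add: \<theta>_eq_iff)
    qed
    then show ?thesis using P_zero[of i j v] ij by simp
  qed
  show ?thesis
  proof (cases "0 < i \<or> j < d")
    case True then show ?thesis using interior ij by blast
  next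
    case False
    then have "i = 0" "j = d" using ij by auto
    moreover have "\<forall>v. E 0 (As (E d v)) = 0"
      using corner_zero_iff[OF sb] interior d eq \<eta>(3)[of 1] \<eta>(3)[of d] by simp
    ultimately show ?thesis by blast
  qed
qed

section \<open>From tridiagonality to the recurrences\<close>

lemma tridiagonal_commutator:
  assumes tri: "\<And>i j v. i + 1 < j \<Longrightarrow> j \<le> d \<Longrightarrow> E i (As (E j v)) = 0"
  obtains Z where "Vector_Spaces.linear scale scale Z" and "\<And>v. Z (A v) = A (Z v)"
    and "\<And>v. A (A (As (A v))) - A (As (A (A v))) = Z (As v) - As (Z v)"
proof -
  \<comment> \<open>Between \<open>E i\<close> and \<open>E j\<close> the two sides carry the
    factors \<open>\<theta> i * \<theta> j * (\<theta> i - \<theta> j)\<close> and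
    \<open>z i - z j\<close>. Only neighbouring indices impose a condition on \<open>z\<close>, and
    a telescoping sum meets all of these.\<close>
  define z where "z i = - (\<Sum>h<i. \<theta> h * \<theta> (h + 1) * (\<theta> h - \<theta> (h + 1)))" for i
  define Z where "Z v = (\<Sum>i\<le>d. z i *s E i v)" for v
  have lin: "Vector_Spaces.linear scale scale Z"
    unfolding module_hom_iff_linear[symmetric]
    by unfold_locales
      (simp_all add: Z_def E_simps algebra_simps sum.distrib scale_sum_right)
  have E_Z: "E i (Z v) = z i *s E i v" if "i \<le> d" for i v
  proof -
    have "E i (Z v) = (\<Sum>j\<le>d. z j *s E i (E j v))" using that by (simp add: Z_def E_simps)
    also have "\<dots> = (\<Sum>j\<le>d. if j = i then z i *s E i v else 0)"
      using that by (intro sum.cong) (auto simp: E_E)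
    finally show ?thesis using that by simp
  qed
  have comm: "Z (A v) = A (Z v)" for v
    by (rule vector_eqI) (simp add: E_Z E_A algebra_simps)
  have "A (A (As (A v))) - A (As (A (A v))) = Z (As v) - As (Z v)" for v
  proof (rule vector_eqI)
    fix i assume i: "i \<le> d"
    have expand: "E i (As w) = (\<Sum>j\<le>d. c j *s E i (As (E j v)))"
      if "\<And>j. j \<le> d \<Longrightarrow> E j w = c j *s E j v" for w c
      using that by (subst E_As_expand[OF i]) (simp add: star.A_simps E_simps i)
    have "E i (A (A (As (A v))) - A (As (A (A v))) - (Z (As v) - As (Z v)))
      = (\<theta> i * \<theta> i) *s E i (As (A v)) - \<theta> i *s E i (As (A (A v))) - (z i *s E i (As v) - E i (As (Z v)))"
      using i by (simp add: E_simps E_A E_Z)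
    also have "\<dots> = (\<Sum>j\<le>d. (\<theta> i * \<theta> i * \<theta> j - \<theta> i * (\<theta> j * \<theta> j) - (z i - z j)) *s E i (As (E j v)))"
      using expand[of "A v" \<theta>] expand[of "A (A v)" "\<lambda>j. \<theta> j * \<theta> j"] expand[of v "\<lambda>_. 1"] expand[of "Z v" z]
      by (simp add: E_A E_Z scale_sum_right scale_left_diff_distrib sum_subtractf)
    also have "\<dots> = 0"
    proof (intro sum.neutral ballI)
      fix j assume "j \<in> {..d}"
      consider "i + 1 < j" | "j + 1 < i" | "j = i" | "j = i + 1" | "i = j + 1" by linarith
      then show "(\<theta> i * \<theta> i * \<theta> j - \<theta> i * (\<theta> j * \<theta> j) - (z i - z j)) *s E i (As (E j v)) = 0"
        by cases (use \<open>j \<in> {..d}\<close> i tri hessenberg_zero in \<open>auto simp: z_def algebra_simps\<close>)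
    qed
    finally show "E i (A (A (As (A v))) - A (As (A (A v)))) = E i (Z (As v) - As (Z v))"
      using i by (simp add: E_simps)
  qed
  then show ?thesis using that lin comm by blast
qed

text \<open>The vector \<open>u 0\<close> is cyclic for \<open>A\<close> and \<open>Z\<close>
  commutes with \<open>A\<close>, so \<open>Z\<close> is determined by \<open>Z (u 0)\<close>. As
  this is a combination of \<open>u 0\<close> up to \<open>u 3\<close>, \<open>Z\<close> is a
  polynomial of degree at most three in \<open>A\<close>.\<close>

lemma tridiagonal_cubic_relation:
  assumes sb: "split_basis u \<phi>" and d: "3 \<le> d"
    and tri: "\<And>i j v. i + 1 < j \<Longrightarrow> j \<le> d \<Longrightarrow> E i (As (E j v)) = 0"
  obtains q r m where "\<And>v. A (A (As (A v))) - A (As (A (A v)))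
    = q *s (A (A (A (As v))) - As (A (A (A v)))) + r *s (A (A (As v)) - As (A (A v))) + m *s (A (As v) - As (A v))"
proof -
  obtain Z where Z_lin: "Vector_Spaces.linear scale scale Z" and comm: "\<And>v. Z (A v) = A (Z v)"
    and rel: "\<And>v. A (A (As (A v))) - A (As (A (A v))) = Z (As v) - As (Z v)"
    using tridiagonal_commutator[OF tri] by metis
  note Z_simps = linear_rules[OF Z_lin]
  obtain f where f: "\<And>k x y. k \<le> d \<Longrightarrow> f k (x + y) = f k x + f k y"
    "\<And>k x y. k \<le> d \<Longrightarrow> f k (x - y) = f k x - f k y"
    "\<And>k c x. k \<le> d \<Longrightarrow> f k (c *s x) = c * f k x"
    "\<And>k j. k \<le> d \<Longrightarrow> f k (u j) = (if j = k then 1 else 0 :: 'f)"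
    by (rule split_basis_coordinates[OF sb]) blast
  define t where "t i = \<theta> (d + 1 - i)" for i
  have t: "t (i + 1) = \<theta> (d - i)" for i by (simp add: t_def)
  note act = split_basis_action[OF sb t refl]
  have A_u: "A (u i) = t (Suc i) *s u i + u (Suc i)" for i using act(1)[of i] by simp
  have As_u: "As (u (Suc i)) = \<theta>s (Suc i) *s u (Suc i) + \<phi> (Suc i) *s u i" for i using act(2)[of "Suc i"] by simp
  have \<phi>0: "\<phi> 0 = 0" and \<phi>d: "\<phi> (d + 1) = 0" using sb by (auto simp: split_basis_def)
  have As_u0: "As (u 0) = \<theta>s 0 *s u 0" using act(2)[of 0] \<phi>0 by simp
  \<comment> \<open>The case distinction keeps the undetermined functional \<open>f (d + 1)\<close>
    out of the formula.\<close>
  have f_As: "f k (As v) = \<theta>s k * f k v + \<phi> (k + 1) * (if k = d then 0 else f (k + 1) v)" if "k \<le> d" for k v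
  proof (induction v rule: split_basis_induct[OF sb])
    case (1 i)
    then show ?case using that by (cases i) (auto simp: As_u0 As_u f)
  qed (use that in \<open>auto simp: star.A_simps f algebra_simps\<close>)
  \<comment> \<open>For \<open>k > 3\<close> the coefficient of \<open>u k\<close> vanishes on the left of \<open>rel\<close> applied to \<open>u 0\<close>, and on
    the right it is \<open>(\<theta>s 0 - \<theta>s k) * f k (Z (u 0))\<close> up to the coefficient at \<open>k + 1\<close>.\<close>
  have high: "f k (Z (u 0)) = 0" if "4 \<le> k" "k \<le> d" for k
    using that
  proof (induction "d - k" arbitrary: k rule: less_induct)
    case less
    have "f k (A (A (As (A (u 0)))) - A (As (A (A (u 0))))) = 0"
      using less.prems by (simp add: A_u As_u As_u0 A_simps star.A_simps f)
    moreover have "f k (Z (As (u 0)) - As (Z (u 0)))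
      = (\<theta>s 0 - \<theta>s k) * f k (Z (u 0)) - \<phi> (k + 1) * (if k = d then 0 else f (k + 1) (Z (u 0)))"
      using less.prems by (simp add: As_u0 Z_simps f f_As left_diff_distrib)
    moreover have "(if k = d then 0 else f (k + 1) (Z (u 0))) = 0"
      using less.hyps[of "k + 1"] less.prems by auto
    ultimately have "(\<theta>s 0 - \<theta>s k) * f k (Z (u 0)) = 0" unfolding rel by simp
    then show ?case using less.prems by (simp add: star.\<theta>_eq_iff)
  qed
  have f_expand: "v = (\<Sum>k\<le>d. f k v *s u k)" for v
  proof (induction v rule: split_basis_induct[OF sb])
    case (1 k)
    have "(\<Sum>j\<le>d. f j (u k) *s u j) = (\<Sum>j\<le>d. if j = k then u k else 0)"
      by (intro sum.cong) (auto simp: f)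
    then show ?case using 1 by simp
  next
    case (2 x y)
    have "(\<Sum>k\<le>d. f k (x + y) *s u k) = (\<Sum>k\<le>d. f k x *s u k) + (\<Sum>k\<le>d. f k y *s u k)"
      by (simp add: f algebra_simps sum.distrib)
    then show ?case using 2 by metis
  next
    case (3 c x)
    have "(\<Sum>k\<le>d. f k (c *s x) *s u k) = c *s (\<Sum>k\<le>d. f k x *s u k)"
      by (simp add: f scale_sum_right)
    then show ?case using 3 by metis
  qed
  define c where "c k = f k (Z (u 0))" for k
  have "Z (u 0) = (\<Sum>k\<le>d. c k *s u k)" unfolding c_def by (rule f_expand)
  also have "\<dots> = (\<Sum>k\<in>{0, 1, 2, 3}. c k *s u k)"
    using d high by (intro sum.mono_neutral_right) (auto simp: c_def)
  also have "\<dots> = c 0 *s u 0 + c 1 *s u 1 + c 2 *s u 2 + c 3 *s u 3" by (simp add: algebra_simps)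
  finally have Z_u0: "Z (u 0) = c 0 *s u 0 + c 1 *s u 1 + c 2 *s u 2 + c 3 *s u 3" .
  have u1: "u 1 = A (u 0) - t 1 *s u 0" and u2: "u 2 = A (u 1) - t 2 *s u 1"
    and u3: "u 3 = A (u 2) - t 3 *s u 2"
    using A_u[of 0] A_u[of 1] A_u[of 2] by (simp_all add: numeral_eq_Suc)
  \<comment> \<open>Expanding \<open>u k\<close> as the product of the factors
    \<open>A - t j\<close>, for \<open>j\<close> from 1 to \<open>k\<close>, applied to
    \<open>u 0\<close> yields these coefficients through elementary symmetric functions of
    \<open>t 1\<close>, \<open>t 2\<close>, \<open>t 3\<close>.\<close>
  define m r where "m = c 1 - c 2 * (t 1 + t 2) + c 3 * (t 1 * t 2 + t 1 * t 3 + t 2 * t 3)"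
    and "r = c 2 - c 3 * (t 1 + t 2 + t 3)"
  define l where "l = c 0 - c 1 * t 1 + c 2 * t 1 * t 2 - c 3 * t 1 * t 2 * t 3"
  define Q where "Q v = c 3 *s A (A (A v)) + r *s A (A v) + m *s A v + l *s v" for v
  have Q_simps: "Q (x + y) = Q x + Q y" "Q (k *s x) = k *s Q x" "Q (A x) = A (Q x)" for x y k
    by (simp_all add: Q_def A_simps algebra_simps)
  have "Z (u k) = Q (u k)" for k
  proof (induction k)
    case 0
    show ?case unfolding Z_u0 u3 u2 u1 Q_def m_def r_def l_def by (simp add: A_simps algebra_simps)
  next
    case (Suc k)
    have "u (Suc k) = A (u k) + (- t (Suc k)) *s u k" using A_u[of k] by (simp add: algebra_simps)
    then show ?case using Suc by (simp only: Q_simps Z_simps comm)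
  qed
  then have "Z v = Q v" for v
    by (induction v rule: split_basis_induct[OF sb]) (simp_all add: Q_simps Z_simps)
  \<comment> \<open>The constant term \<open>l\<close> cancels in the commutator with
    \<open>As\<close>.\<close>
  then have "A (A (As (A v))) - A (As (A (A v)))
    = c 3 *s (A (A (A (As v))) - As (A (A (A v)))) + r *s (A (A (As v)) - As (A (A v))) + m *s (A (As v) - As (A v))" for v
    unfolding rel by (simp add: Q_def star.A_simps algebra_simps)
  then show ?thesis by (rule that)
qed

text \<open>One cubic relation yields all three recurrences with the same \<open>q\<close>: its
  subdiagonal blocks give the one for \<open>\<theta>\<close>, and its coefficients at
  \<open>u (i + 3)\<close> and \<open>u (i + 2)\<close> those for \<open>\<theta>s\<close> and
  \<open>\<eta>\<close>.\<close>

lemma tridiagonal_imp_recurrent: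
  fixes \<eta> :: "nat \<Rightarrow> 'f"
  assumes sb: "split_basis u \<phi>" and d: "3 \<le> d"
    and \<eta>: "\<eta> 0 = 0" "\<eta> (d + 1) = 0"
      "\<And>i. 1 \<le> i \<Longrightarrow> i \<le> d \<Longrightarrow> \<eta> i = \<phi> i - (\<theta>s i - \<theta>s 0) * (\<theta> (d - i + 1) - \<theta> 0)"
    and tri: "\<And>i j v. i + 1 < j \<Longrightarrow> j \<le> d \<Longrightarrow> E i (As (E j v)) = 0"
  shows "\<eta> 1 = \<eta> d \<and>
    (\<exists>\<beta>. beta_recurrent \<beta> d \<theta> \<and> beta_recurrent \<beta> d \<theta>s \<and> beta_recurrent \<beta> (d + 1) \<eta>)"
proof
  show "\<eta> 1 = \<eta> d" using corner_zero_iff[OF sb] d tri \<eta>(3)[of 1] \<eta>(3)[of d] by simp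
next
  obtain q r m where rel: "\<And>v. A (A (As (A v))) - A (As (A (A v)))
    = q *s (A (A (A (As v))) - As (A (A (A v)))) + r *s (A (A (As v)) - As (A (A v))) + m *s (A (As v) - As (A v))"
    using tridiagonal_cubic_relation[OF sb d tri] by metis
  obtain f where f: "\<And>k x y. k \<le> d \<Longrightarrow> f k (x + y) = f k x + f k y"
    "\<And>k x y. k \<le> d \<Longrightarrow> f k (x - y) = f k x - f k y"
    "\<And>k c x. k \<le> d \<Longrightarrow> f k (c *s x) = c * f k x"
    "\<And>k j. k \<le> d \<Longrightarrow> f k (u j) = (if j = k then 1 else 0 :: 'f)"
    by (rule split_basis_coordinates[OF sb]) blast
  have \<theta>_eq: "\<theta> i * \<theta> (i + 1) = q * (\<theta> i * \<theta> i + \<theta> i * \<theta> (i + 1) + \<theta> (i + 1) * \<theta> (i + 1)) + r * (\<theta> i + \<theta> (i + 1)) + m"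
    if i: "i < d" for i
  proof -
    obtain v where v: "E (Suc i) (As (E i v)) \<noteq> 0" using hessenberg_nonzero[OF i] by blast
    let ?x = "\<theta> (Suc i)" and ?y = "\<theta> i"
    have "(?x * ?x * ?y - ?x * (?y * ?y) - q * (?x * ?x * ?x - ?y * ?y * ?y) - r * (?x * ?x - ?y * ?y) - m * (?x - ?y))
        *s E (Suc i) (As (E i v)) = 0"
      using arg_cong[OF rel[of "E i v"], of "E (Suc i)"] i
      by (simp add: E_simps star.A_simps A_simps E_A A_E algebra_simps)
    then have "?x * ?x * ?y - ?x * (?y * ?y) - q * (?x * ?x * ?x - ?y * ?y * ?y) - r * (?x * ?x - ?y * ?y) - m * (?x - ?y) = 0"
      using v by simp
    then have "(?x - ?y) * (?y * ?x - (q * (?y * ?y + ?y * ?x + ?x * ?x) + r * (?y + ?x) + m)) = 0"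
      by (simp add: algebra_simps)
    moreover have "?x - ?y \<noteq> 0" using i by (simp add: \<theta>_eq_iff)
    ultimately show ?thesis by simp
  qed
  \<comment> \<open>Two consecutive instances of \<open>\<theta>_eq\<close> are subtracted and the
    nonzero factor \<open>\<theta> (i + 2) - \<theta> i\<close> is cancelled.\<close>
  have \<theta>_rec: "\<theta> (i + 1) = q * (\<theta> i + \<theta> (i + 1) + \<theta> (i + 2)) + r" if "i + 2 \<le> d" for i
  proof -
    have "(\<theta> (i + 2) - \<theta> i) * (\<theta> (i + 1) - (q * (\<theta> i + \<theta> (i + 1) + \<theta> (i + 2)) + r))
      = \<theta> (i + 1) * \<theta> (i + 1 + 1) - \<theta> i * \<theta> (i + 1)
        - (q * (\<theta> (i + 1) * \<theta> (i + 1) + \<theta> (i + 1) * \<theta> (i + 1 + 1) + \<theta> (i + 1 + 1) * \<theta> (i + 1 + 1)) + r * (\<theta> (i + 1) + \<theta> (i + 1 + 1)) + m)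
        + (q * (\<theta> i * \<theta> i + \<theta> i * \<theta> (i + 1) + \<theta> (i + 1) * \<theta> (i + 1)) + r * (\<theta> i + \<theta> (i + 1)) + m)"
      by (simp add: algebra_simps)
    also have "\<dots> = 0" using \<theta>_eq[of i] \<theta>_eq[of "i + 1"] that by simp
    finally show ?thesis using that by (simp add: \<theta>_eq_iff)
  qed
  have \<phi>0: "\<phi> 0 = 0" and \<phi>d: "\<phi> (d + 1) = 0" using sb by (auto simp: split_basis_def)
  \<comment> \<open>The extra values \<open>t 0\<close> and \<open>s (d + 1)\<close> are solved from
    \<open>t_rec\<close> at \<open>i = 0\<close> and \<open>s_rec'\<close> at
    \<open>i = d - 2\<close>. They are needed because the recurrence of \<open>\<eta>\<close> runs
    one index further than the others.\<close>
  define t where "t i = (if i = 0 then (\<theta> d - r) / q - \<theta> d - \<theta> (d - 1) else \<theta> (d + 1 - i))" for i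
  define s where "s i = (if i \<le> d then \<theta>s i else \<theta>s (d - 2) - (\<theta>s (d - 1) - \<theta>s d) / q)" for i
  define p where "p i = \<phi> i *s u (i - 1)" for i
  have actions: "A (u i) = t (Suc i) *s u i + u (Suc i)" "As (u i) = s i *s u i + p i"
    "A (p i) = t i *s p i + \<phi> i *s u i" for i
    using split_basis_action[OF sb, of t s i] by (simp_all add: t_def s_def p_def)
  have p_Suc: "p (Suc i) = \<phi> (Suc i) *s u i" for i by (simp add: p_def)
  have f_0: "f k 0 = 0" if "k \<le> d" for k using f(3)[OF that, of 0 0] by simp
  have f_p: "f k (p i) = 0" if "k \<le> d" "i \<le> k" for k i
    using that \<phi>0 by (cases i) (auto simp: p_def f f_0)
  \<comment> \<open>On \<open>u i\<close> the relation reaches up to \<open>u (i + 3)\<close>, and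
    the coefficient there involves only \<open>s\<close> and \<open>q\<close>.\<close>
  have s_rec: "s (i + 1) - s (i + 2) = q * (s i - s (i + 3))" if "i + 3 \<le> d" for i
    using arg_cong[OF rel[of "u i"], of "f (i + 3)"] that
    by (simp add: actions p_Suc A_simps star.A_simps f f_p numeral_eq_Suc algebra_simps)
  have q: "q \<noteq> 0"
  proof
    assume "q = 0"
    then have "\<theta>s 1 = \<theta>s 2" using s_rec[of 0] d by (simp add: s_def numeral_eq_Suc)
    then show False using d by (simp add: star.\<theta>_eq_iff)
  qed
  have coeff: "\<phi> (i + 1) - \<phi> (i + 2) + t (i + 1) * s i + s (i + 1) * (t (i + 2) + t (i + 3)) 
      - (t (i + 1) + t (i + 2)) * s (i + 1) - s (i + 2) * t (i + 3)
    = q * (\<phi> i - \<phi> (i + 3) + (s i - s (i + 2)) * (t (i + 1) + t (i + 2) + t (i + 3))) + r * (s i - s (i + 2))"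
    if "i + 2 \<le> d" for i
    using arg_cong[OF rel[of "u i"], of "f (i + 2)"] that
    by (simp add: actions p_Suc A_simps star.A_simps f f_p numeral_eq_Suc algebra_simps)
  have s_rec': "s (i + 1) - s (i + 2) = q * (s i - s (i + 3))" if i: "i + 2 \<le> d" for i
  proof (cases "i + 3 \<le> d")
    case True then show ?thesis by (rule s_rec)
  next
    case False
    then have "d = i + 2" using i by simp
    then show ?thesis using q by (simp add: s_def)
  qed
  have t_rec: "t (i + 1) = q * (t i + t (i + 1) + t (i + 2)) + r" if i: "i < d" for i
  proof (cases "i = 0")
    case True then show ?thesis using q d by (simp add: t_def field_simps)
  next
    case False
    define k where "k = d - 1 - i"
    have "d + 1 - i = k + 2" "d + 1 - (i + 1) = k + 1" "d + 1 - (i + 2) = k" "k + 2 \<le> d"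
      using i False by (auto simp: k_def)
    then have "t i = \<theta> (k + 2)" "t (i + 1) = \<theta> (k + 1)" "t (i + 2) = \<theta> k"
      using False by (simp_all add: t_def)
    then show ?thesis using \<theta>_rec[OF \<open>k + 2 \<le> d\<close>] by (simp add: algebra_simps)
  qed
  have \<phi>: "\<phi> i = \<eta> i + (s i - s 0) * (t i - t (d + 1))" if i: "i \<le> d + 1" for i
  proof -
    consider "i = 0" | "i = d + 1" | "1 \<le> i" "i \<le> d" using i by linarith
    then show ?thesis
    proof cases
      case 3
      then have "d + 1 - i = d - i + 1" by simp
      then show ?thesis using \<eta>(3)[of i] 3 by (simp add: s_def t_def)
    qed (use \<phi>0 \<phi>d \<eta> in auto)
  qed
  have "\<theta> (i + 1) - \<theta> (i + 2) = q * (\<theta> i - \<theta> (i + 3))" if "i + 3 \<le> d" for i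
  proof -
    have "\<theta> (i + 2) = q * (\<theta> (i + 1) + \<theta> (i + 2) + \<theta> (i + 3)) + r"
      using \<theta>_rec[of "i + 1"] that by (simp add: numeral_eq_Suc)
    moreover have "\<theta> (i + 1) = q * (\<theta> i + \<theta> (i + 1) + \<theta> (i + 2)) + r"
      using \<theta>_rec[of i] that by simp
    ultimately show ?thesis by algebra
  qed
  moreover have "\<theta>s (i + 1) - \<theta>s (i + 2) = q * (\<theta>s i - \<theta>s (i + 3))" if "i + 3 \<le> d" for i
    using s_rec[OF that] that by (simp add: s_def)
  moreover have "\<eta> (i + 1) - \<eta> (i + 2) = q * (\<eta> i - \<eta> (i + 3))" if "i + 3 \<le> d + 1" for i
  proof -
    have i: "i + 2 \<le> d" using that by simp
    have "t (i + 2) = q * (t (i + 1) + t (i + 2) + t (i + 3)) + r"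
      using t_rec[of "i + 1"] i by (simp add: numeral_eq_Suc)
    moreover have "\<phi> i = \<eta> i + (s i - s 0) * (t i - t (d + 1))"
      "\<phi> (i + 1) = \<eta> (i + 1) + (s (i + 1) - s 0) * (t (i + 1) - t (d + 1))"
      "\<phi> (i + 2) = \<eta> (i + 2) + (s (i + 2) - s 0) * (t (i + 2) - t (d + 1))"
      "\<phi> (i + 3) = \<eta> (i + 3) + (s (i + 3) - s 0) * (t (i + 3) - t (d + 1))"
      using that by (simp_all only: \<phi>)
    moreover have "t (i + 1) = q * (t i + t (i + 1) + t (i + 2)) + r"
      using t_rec[of i] i by simp
    ultimately show ?thesis using coeff[OF i] s_rec'[OF i] by algebra
  qed
  ultimately show "\<exists>\<beta>. beta_recurrent \<beta> d \<theta> \<and> beta_recurrent \<beta> d \<theta>s \<and> beta_recurrent \<beta> (d + 1) \<eta>"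
    using beta_recurrent_iff_ratio[OF q] by blast
qed

end

section \<open>Exchanging \<open>A\<close> and \<open>As\<close>\<close>

lemma beta_recurrent_rev_iff:
  "beta_recurrent \<beta> n (\<lambda>i. \<sigma> (n - i)) \<longleftrightarrow> beta_recurrent \<beta> n \<sigma>"
proof
  assume "beta_recurrent \<beta> n (\<lambda>i. \<sigma> (n - i))"
  from beta_recurrent_rev[OF this] show "beta_recurrent \<beta> n \<sigma>"
    by (simp add: beta_recurrent_iff)
qed (rule beta_recurrent_rev)

context hessenberg_frame
begin

lemma tridiagonal_iff_recurrent:
  fixes \<eta> :: "nat \<Rightarrow> 'f"
  assumes "split_basis u \<phi>" and "3 \<le> d" and "\<eta> 0 = 0" and "\<eta> (d + 1) = 0"
    and "\<And>i. 1 \<le> i \<Longrightarrow> i \<le> d \<Longrightarrow> \<eta> i = \<phi> i - (\<theta>s i - \<theta>s 0) * (\<theta> (d - i + 1) - \<theta> 0)"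
  shows "(\<forall>i j v. i + 1 < j \<longrightarrow> j \<le> d \<longrightarrow> E i (As (E j v)) = 0) \<longleftrightarrow>
    \<eta> 1 = \<eta> d \<and>
    (\<exists>\<beta>. beta_recurrent \<beta> d \<theta> \<and> beta_recurrent \<beta> d \<theta>s \<and> beta_recurrent \<beta> (d + 1) \<eta>)"
  using tridiagonal_imp_recurrent[OF assms] recurrent_imp_tridiagonal[OF assms] by metis

text \<open>In the reversed basis \<open>As\<close> is lower and \<open>A\<close> upper bidiagonal.
  Rescaling turns the subdiagonal entries of \<open>As\<close> into ones.\<close>

lemma split_basis_dual:
  assumes sb: "split_basis u \<phi>"
  shows "\<exists>u'. hessenberg_frame.split_basis scale d As A \<theta>s \<theta> u' (\<lambda>i. \<phi> (d + 1 - i))"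
proof -
  interpret D: hessenberg_frame scale d As Es A E \<theta>s \<theta> by (rule dual)
  have u_zero: "\<And>i. d < i \<Longrightarrow> u i = 0" and \<phi>0: "\<phi> 0 = 0" and \<phi>d: "\<phi> (d + 1) = 0"
    and \<phi>_nz: "\<And>i. 1 \<le> i \<Longrightarrow> i \<le> d \<Longrightarrow> \<phi> i \<noteq> 0"
    and Au: "\<And>i. i \<le> d \<Longrightarrow> A (u i) = \<theta> (d - i) *s u i + u (i + 1)"
    and Asu: "\<And>i. i \<le> d \<Longrightarrow> As (u i) = \<theta>s i *s u i + \<phi> i *s u (i - 1)"
    and spans: "\<And>v. \<exists>c. v = (\<Sum>k\<le>d. c k *s u k)"
    and indep: "\<And>c. (\<Sum>k\<le>d. c k *s u k) = 0 \<Longrightarrow> \<forall>k\<le>d. c k = 0"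
    using sb by (auto simp: split_basis_def)
  \<comment> \<open>The product of the last \<open>i\<close> scalars \<open>\<phi>\<close> is the
    factor that \<open>As\<close> accumulates along the reversed basis.\<close>
  define c where "c i = (\<Prod>h<i. \<phi> (d - h))" for i
  define u' where "u' i = (if i \<le> d then c i *s u (d - i) else 0)" for i
  have c_nz: "c i \<noteq> 0" if "i \<le> d" for i using that by (auto simp: c_def \<phi>_nz)
  have rev: "(\<Sum>k\<le>d. g (d - k)) = (\<Sum>k\<le>d. g k)" for g :: "nat \<Rightarrow> 'v"
    by (rule sum.reindex_bij_witness[of _ "\<lambda>k. d - k" "\<lambda>k. d - k"]) auto
  have As_u': "As (u' i) = \<theta>s (d - i) *s u' i + u' (i + 1)" if "i \<le> d" for i
  proof (cases "i = d")
    case True then show ?thesis by (simp add: u'_def Asu \<phi>0 star.A_simps algebra_simps)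
  next
    case False
    then show ?thesis using that
      by (simp add: u'_def c_def Asu star.A_simps algebra_simps)
  qed
  have A_u': "A (u' i) = \<theta> i *s u' i + \<phi> (d + 1 - i) *s u' (i - 1)" if "i \<le> d" for i
  proof (cases i)
    case 0 then show ?thesis using \<phi>d by (simp add: u'_def Au A_simps u_zero algebra_simps)
  next
    case (Suc k)
    then have "Suc (d - Suc k) = d - k" "d + 1 - i = d - k" using that by auto
    then show ?thesis using that Suc
      by (simp add: u'_def c_def Au A_simps algebra_simps)
  qed
  have sum_u': "(\<Sum>k\<le>d. b k *s u' k) = (\<Sum>k\<le>d. (b (d - k) * c (d - k)) *s u k)" for b
    by (subst rev[symmetric]) (simp add: u'_def)
  have "\<exists>b. v = (\<Sum>k\<le>d. b k *s u' k)" for v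
  proof -
    obtain a where "v = (\<Sum>k\<le>d. a k *s u k)" using spans by blast
    also have "\<dots> = (\<Sum>k\<le>d. (a (d - k) / c k) *s u' k)"
      unfolding sum_u' by (intro sum.cong) (auto simp: c_nz)
    finally show ?thesis by (rule exI[of _ "\<lambda>k. a (d - k) / c k"])
  qed
  moreover have "\<forall>k\<le>d. b k = 0" if "(\<Sum>k\<le>d. b k *s u' k) = 0" for b
  proof (intro allI impI)
    fix k assume "k \<le> d"
    then show "b k = 0" using indep[OF that[unfolded sum_u']] c_nz[of k]
      by (auto dest: spec[of _ "d - k"])
  qed
  ultimately have "D.split_basis u' (\<lambda>i. \<phi> (d + 1 - i))"
    unfolding D.split_basis_def using As_u' A_u' \<phi>0 \<phi>d by (auto simp: u'_def \<phi>_nz)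
  then show ?thesis by blast
qed

text \<open>For the dual frame the third sequence is the reversed \<open>\<eta>\<close>. Reversal
  swaps \<open>\<eta> 1\<close> with \<open>\<eta> d\<close> and preserves recurrence, so the
  condition stays the same.\<close>

lemma star_tridiagonal_iff_recurrent:
  fixes \<eta> :: "nat \<Rightarrow> 'f"
  assumes sb: "split_basis u \<phi>" and d: "3 \<le> d" and "\<eta> 0 = 0" and "\<eta> (d + 1) = 0"
    and \<eta>: "\<And>i. 1 \<le> i \<Longrightarrow> i \<le> d \<Longrightarrow> \<eta> i = \<phi> i - (\<theta>s i - \<theta>s 0) * (\<theta> (d - i + 1) - \<theta> 0)"
  shows "(\<forall>i j v. i + 1 < j \<longrightarrow> j \<le> d \<longrightarrow> Es i (A (Es j v)) = 0) \<longleftrightarrow>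
    \<eta> 1 = \<eta> d \<and>
    (\<exists>\<beta>. beta_recurrent \<beta> d \<theta> \<and> beta_recurrent \<beta> d \<theta>s \<and> beta_recurrent \<beta> (d + 1) \<eta>)"
proof -
  interpret D: hessenberg_frame scale d As Es A E \<theta>s \<theta> by (rule dual)
  obtain u' where u': "D.split_basis u' (\<lambda>i. \<phi> (d + 1 - i))" using split_basis_dual[OF sb] by blast
  have \<eta>': "\<eta> (d + 1 - i) = \<phi> (d + 1 - i) - (\<theta> i - \<theta> 0) * (\<theta>s (d - i + 1) - \<theta>s 0)"
    if "1 \<le> i" "i \<le> d" for i
  proof -
    have "d + 1 - i = d - i + 1" "d - (d + 1 - i) + 1 = i" using that by auto
    then show ?thesis using \<eta>[of "d + 1 - i"] that by (simp add: mult.commute)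
  qed
  have "(\<forall>i j v. i + 1 < j \<longrightarrow> j \<le> d \<longrightarrow> Es i (A (Es j v)) = 0) \<longleftrightarrow>
    \<eta> (d + 1 - 1) = \<eta> (d + 1 - d) \<and>
    (\<exists>\<beta>. beta_recurrent \<beta> d \<theta>s \<and> beta_recurrent \<beta> d \<theta> \<and> beta_recurrent \<beta> (d + 1) (\<lambda>i. \<eta> (d + 1 - i)))"
    by (rule D.tridiagonal_iff_recurrent[OF u' d]) (use assms(3,4) \<eta>' in simp_all)
  then show ?thesis unfolding beta_recurrent_rev_iff by auto
qed

section \<open>From the definitions to the frames\<close>

lemma parameter_array_split_basis:
  assumes pa: "parameter_array d A E As Es \<theta> \<theta>s \<phi>"
  obtains u \<phi>' where "split_basis u \<phi>'" and "\<And>i. 1 \<le> i \<Longrightarrow> i \<le> d \<Longrightarrow> \<phi>' i = \<phi> i"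
proof -
  obtain u \<phi>' where sb: "split_basis u \<phi>'"
    and split: "\<And>i. i \<le> d \<Longrightarrow> split_space d E Es i = {c *s u i | c. True}"
    by (rule split_basis_exists) blast
  \<comment> \<open>The nonzero vector \<open>u i\<close> spans the split space, so only
    \<open>\<phi>' i\<close> fits the definite description. Beyond \<open>1 \<le> i \<le> d\<close>
    the parameter array prescribes nothing, whereas \<open>\<phi>'\<close> is zero at
    \<open>0\<close> and \<open>d + 1\<close>.\<close>
  have "\<phi>' i = \<phi> i" if i: "1 \<le> i" "i \<le> d" for i
  proof -
    have Au: "A (u (i - 1)) = \<theta> (d - i + 1) *s u (i - 1) + u i"
    proof -
      have "A (u (i - 1)) = \<theta> (d - (i - 1)) *s u (i - 1) + u (i - 1 + 1)"
        using sb i by (auto simp: split_basis_def)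
      then show ?thesis using i by (simp add: Suc_diff_le)
    qed
    have Asu: "As (u i) = \<theta>s i *s u i + \<phi>' i *s u (i - 1)" and nz: "\<phi>' i \<noteq> 0"
      using sb i by (auto simp: split_basis_def)
    have act: "((\<lambda>v. A v - \<theta> (d - i + 1) *s v) \<circ> (\<lambda>v. As v - \<theta>s i *s v)) (b *s u i) = \<phi>' i *s b *s u i" for b
      by (simp add: star.A_simps A_simps Au[unfolded One_nat_def] Asu algebra_simps)
    have "u i \<noteq> 0"
    proof
      assume "u i = 0"
      then have "(\<Sum>k\<le>d. (if k = i then 1 else 0) *s u k) = 0" by (intro sum.neutral) auto
      with sb have "\<forall>k\<le>d. (if k = i then 1 else 0 :: 'f) = 0"
        unfolding split_basis_def by (elim conjE allE[where x = "\<lambda>k. if k = i then 1 else 0"]) blast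
      with i show False by auto
    qed
    have "\<phi> i = (THE c. c \<noteq> 0 \<and> (\<forall>u\<in>split_space d E Es i.
           ((\<lambda>v. A v - \<theta> (d - i + 1) *s v) \<circ> (\<lambda>v. As v - \<theta>s i *s v)) u = c *s u))"
      using pa i unfolding parameter_array_def by auto
    also have "\<dots> = \<phi>' i"
    proof (rule the_equality)
      show "\<phi>' i \<noteq> 0 \<and> (\<forall>u\<in>split_space d E Es i.
           ((\<lambda>v. A v - \<theta> (d - i + 1) *s v) \<circ> (\<lambda>v. As v - \<theta>s i *s v)) u = \<phi>' i *s u)"
        using nz act split[OF i(2)] by auto
    next
      fix c assume c: "c \<noteq> 0 \<and> (\<forall>u\<in>split_space d E Es i.
           ((\<lambda>v. A v - \<theta> (d - i + 1) *s v) \<circ> (\<lambda>v. As v - \<theta>s i *s v)) u = c *s u)"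
      have "1 *s u i \<in> split_space d E Es i" unfolding split[OF i(2)] by blast
      then have "\<phi>' i *s 1 *s u i = c *s 1 *s u i" using c act[of 1] by metis
      then show "c = \<phi>' i" using \<open>u i \<noteq> 0\<close> by simp
    qed
    finally show ?thesis by simp
  qed
  with sb show ?thesis by (rule that)
qed

end

context vector_space
begin

text \<open>Diagonalizability supplies a basis of eigenvectors, each belonging to some
  \<open>th j\<close>, on which the linear identities for the \<open>E i\<close> are immediate.
  One-dimensional eigenspaces give the rank condition, and since \<open>E i\<close> is nonzero the
  eigenvalue is unique, so \<open>\<theta>\<close> is the ordering \<open>th\<close>.\<close>

lemma idempotent_frameI:
  assumes mf: "multiplicity_free A" and pi: "primitive_idempotents d A E"
    and \<theta>: "\<And>i. i \<le> d \<Longrightarrow> \<theta> i = eigenvalue_on A (range (E i))"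
  shows "idempotent_frame scale d A E \<theta>"
proof -
  obtain th where th: "bij_betw th {0..d} (eigenvalues A)"
    and lin_E: "\<And>i. i \<le> d \<Longrightarrow> Vector_Spaces.linear scale scale (E i)"
    and E_eig: "\<And>i j v. i \<le> d \<Longrightarrow> j \<le> d \<Longrightarrow> A v = th j *s v \<Longrightarrow> E i v = (if i = j then v else 0)"
    using pi unfolding primitive_idempotents_def eigenspace_def by auto
  have lin_A: "Vector_Spaces.linear scale scale A" and diag: "diagonalizable A"
    and dim1: "\<And>t. t \<in> eigenvalues A \<Longrightarrow> dim (eigenspace A t) = 1"
    using mf unfolding multiplicity_free_def by auto
  obtain B where B: "independent B" "span B = UNIV" "\<And>v. v \<in> B \<Longrightarrow> \<exists>t. A v = t *s v"
    using diag unfolding diagonalizable_def eigenspace_def by auto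
  note A_simps = linear_rules[OF lin_A] and E_simps = linear_rules[OF lin_E]
  have B_th: "\<exists>j\<le>d. A v = th j *s v" if v: "v \<in> B" for v
  proof -
    obtain t where t: "A v = t *s v" using B(3) v by blast
    have "v \<noteq> 0" using B(1) v dependent_zero by blast
    then have "t \<in> eigenvalues A" using t by (auto simp: eigenvalues_def eigenspace_def)
    then have "t \<in> th ` {0..d}" using th by (simp add: bij_betw_def)
    then show ?thesis using t by auto
  qed
  have sum_E: "(\<Sum>i\<le>d. E i v) = v" for v
  proof (induction v rule: span_induct_UNIV[OF B(2)])
    case (2 x)
    then obtain j where j: "j \<le> d" "A x = th j *s x" using B_th by blast
    then have "(\<Sum>i\<le>d. E i x) = (\<Sum>i\<le>d. if i = j then x else 0)"
      by (intro sum.cong) (auto simp: E_eig)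
    then show ?case using j by simp
  qed (simp_all add: E_simps sum.distrib scale_sum_right[symmetric])
  have A_E: "A (E i v) = th i *s E i v" if "i \<le> d" for i v
  proof (induction v rule: span_induct_UNIV[OF B(2)])
    case (2 x)
    then obtain j where "j \<le> d" "A x = th j *s x" using B_th by blast
    then show ?case using that by (auto simp: E_eig A_simps)
  qed (use that in \<open>simp_all add: E_simps A_simps algebra_simps\<close>)
  have E_nonzero: "\<exists>v. E i v \<noteq> 0" if "i \<le> d" for i
  proof -
    have "th i \<in> eigenvalues A" using th that by (auto simp: bij_betw_def)
    then have "eigenspace A (th i) \<noteq> {0}" by (simp add: eigenvalues_def)
    moreover have "0 \<in> eigenspace A (th i)" by (simp add: eigenspace_def A_simps)
    ultimately obtain v where "A v = th i *s v" "v \<noteq> 0" unfolding eigenspace_def by blast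
    then have "E i v \<noteq> 0" using E_eig[of i i v] that by simp
    then show ?thesis by blast
  qed
  have E_rank: "\<exists>c. E i y = c *s E i x" if "i \<le> d" "E i x \<noteq> 0" for i x y
  proof -
    have "th i \<in> eigenvalues A" using th that by (auto simp: bij_betw_def)
    obtain b where b: "eigenspace A (th i) \<subseteq> span {b}"
      using basis_exists[of "eigenspace A (th i)"] dim1[OF \<open>th i \<in> eigenvalues A\<close>]
      by (metis card_1_singletonE)
    have "E i x \<in> eigenspace A (th i)" "E i y \<in> eigenspace A (th i)"
      using A_E that by (simp_all add: eigenspace_def)
    then have "E i x \<in> range (\<lambda>k. k *s b)" "E i y \<in> range (\<lambda>k. k *s b)"
      using b unfolding span_singleton by blast+
    then obtain k l where kl: "E i x = k *s b" "E i y = l *s b" by blast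
    then have "E i y = (l / k) *s E i x" using that(2) by auto
    then show ?thesis by blast
  qed
  have \<theta>_th: "\<theta> i = th i" if i: "i \<le> d" for i
    unfolding \<theta>[OF i] eigenvalue_on_def
  proof (rule the_equality)
    show "\<forall>v\<in>range (E i). A v = th i *s v" using A_E[OF i] by blast
    fix t assume t: "\<forall>v\<in>range (E i). A v = t *s v"
    obtain v where "E i v \<noteq> 0" using E_nonzero[OF i] by blast
    moreover have "t *s E i v = th i *s E i v" using t A_E[OF i, of v] by (metis rangeI)
    ultimately show "t = th i" by simp
  qed
  show ?thesis
  proof unfold_locales
    show "inj_on \<theta> {..d}"
      using th \<theta>_th by (auto simp: bij_betw_def inj_on_def)
    show "E i (E j v) = (if i = j then E i v else 0)" if "i \<le> d" "j \<le> d" for i j v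
      using E_eig[OF that A_E[OF that(2)], of v] by simp
  qed (use sum_E A_E E_rank E_nonzero \<theta>_th in \<open>auto simp: A_simps E_simps\<close>)
qed

lemma hessenberg_frameI:
  assumes hs: "hessenberg_system d A E As Es" and pa: "parameter_array d A E As Es \<theta> \<theta>s \<phi>"
  shows "hessenberg_frame scale d A E As Es \<theta> \<theta>s"
proof -
  interpret idempotent_frame scale d A E \<theta>
    using hs pa by (intro idempotent_frameI) (auto simp: hessenberg_system_def parameter_array_def)
  interpret star: idempotent_frame scale d As Es \<theta>s
    using hs pa by (intro idempotent_frameI) (auto simp: hessenberg_system_def parameter_array_def)
  show ?thesis
  proof unfold_locales
    fix i j v assume ij: "i \<le> d" "j + 1 < i"
    then have "E i \<circ> As \<circ> E j = (\<lambda>_. 0)" "Es i \<circ> A \<circ> Es j = (\<lambda>_. 0)"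
      using hs unfolding hessenberg_system_def by auto
    then show "E i (As (E j v)) = 0" "Es i (A (Es j v)) = 0" by (auto simp: fun_eq_iff)
  next
    fix j assume j: "j < d"
    have "i = j + 1 \<Longrightarrow> i \<le> d \<Longrightarrow> j \<le> d \<Longrightarrow>
        E i \<circ> As \<circ> E j \<noteq> (\<lambda>_. 0) \<and> Es i \<circ> A \<circ> Es j \<noteq> (\<lambda>_. 0)" for i
      using hs unfolding hessenberg_system_def by blast
    from this[of "j + 1"]
    have "E (j + 1) \<circ> As \<circ> E j \<noteq> (\<lambda>_. 0)" "Es (j + 1) \<circ> A \<circ> Es j \<noteq> (\<lambda>_. 0)"
      using j by simp_all
    then show "\<exists>v. E (Suc j) (As (E j v)) \<noteq> 0" "\<exists>v. Es (Suc j) (A (Es j v)) \<noteq> 0"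
      by (auto simp: fun_eq_iff)
  qed
qed

end

section \<open>Equivalence of the four conditions\<close>

theorem proposition12p2:
  fixes scale :: "'f::field \<Rightarrow> 'v::ab_group_add \<Rightarrow> 'v"
    and d :: nat
    and A As :: "'v \<Rightarrow> 'v"
    and E Es :: "nat \<Rightarrow> 'v \<Rightarrow> 'v"
    and \<theta> \<theta>s \<phi> vartheta :: "nat \<Rightarrow> 'f"
  assumes "d \<ge> 3"
    and "vector_space scale"
    and "vector_space.dim scale (UNIV :: 'v set) = d + 1"
    and "vector_space.hessenberg_system scale d A E As Es"
    and "vector_space.parameter_array scale d A E As Es \<theta> \<theta>s \<phi>"
    and "vartheta 0 = 0"
    and "vartheta (d + 1) = 0"
    and "\<And>i. 1 \<le> i \<Longrightarrow> i \<le> d \<Longrightarrow> vartheta i = \<phi> i - (\<theta>s i - \<theta>s 0) * (\<theta> (d - i + 1) - \<theta> 0)"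
  shows "let cond_i = (\<forall>i\<le>d. \<forall>j\<le>d. j > i + 1 \<longrightarrow> E i \<circ> As \<circ> E j = (\<lambda>_. 0));
             cond_ii = (\<forall>i\<le>d. \<forall>j\<le>d. j > i + 1 \<longrightarrow> Es i \<circ> A \<circ> Es j = (\<lambda>_. 0));
             cond_iii = (vartheta 1 = vartheta d \<and>
               (\<exists>\<beta>. beta_recurrent \<beta> d \<theta> \<and> beta_recurrent \<beta> d \<theta>s \<and>
                    beta_recurrent \<beta> (d + 1) vartheta));
             cond_iv = vector_space.tridiagonal_hessenberg_system scale d A E As Es
         in (cond_i \<longleftrightarrow> cond_ii) \<and> (cond_ii \<longleftrightarrow> cond_iii) \<and> (cond_iii \<longleftrightarrow> cond_iv)"
proof -
  interpret vector_space scale by (fact assms(2))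
  interpret hessenberg_frame scale d A E As Es \<theta> \<theta>s
    using assms(4,5) by (rule hessenberg_frameI)
  obtain u \<phi>' where sb: "split_basis u \<phi>'" and \<phi>': "\<And>i. 1 \<le> i \<Longrightarrow> i \<le> d \<Longrightarrow> \<phi>' i = \<phi> i"
    by (rule parameter_array_split_basis[OF assms(5)]) blast
  have vartheta: "vartheta i = \<phi>' i - (\<theta>s i - \<theta>s 0) * (\<theta> (d - i + 1) - \<theta> 0)" if "1 \<le> i" "i \<le> d" for i
    using assms(8) \<phi>' that by simp
  let ?iii = "vartheta 1 = vartheta d \<and> (\<exists>\<beta>. beta_recurrent \<beta> d \<theta> \<and> beta_recurrent \<beta> d \<theta>s \<and>
    beta_recurrent \<beta> (d + 1) vartheta)"
  \<comment> \<open>The bound \<open>i \<le> d\<close> may be dropped because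
    \<open>i + 1 < j\<close> and \<open>j \<le> d\<close> imply it.\<close>
  have comp: "(\<forall>i\<le>d. \<forall>j\<le>d. j > i + 1 \<longrightarrow> F i \<circ> X \<circ> F j = (\<lambda>_. 0)) \<longleftrightarrow>
      (\<forall>i j v. i + 1 < j \<longrightarrow> j \<le> d \<longrightarrow> F i (X (F j v)) = 0)" for F :: "nat \<Rightarrow> 'v \<Rightarrow> 'v" and X
  proof
    assume *: "\<forall>i\<le>d. \<forall>j\<le>d. j > i + 1 \<longrightarrow> F i \<circ> X \<circ> F j = (\<lambda>_. 0)"
    show "\<forall>i j v. i + 1 < j \<longrightarrow> j \<le> d \<longrightarrow> F i (X (F j v)) = 0"
    proof (intro allI impI)
      fix i j v assume "i + 1 < j" "j \<le> d"
      then have "F i \<circ> X \<circ> F j = (\<lambda>_. 0)" using * by simp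
      then show "F i (X (F j v)) = 0" by (simp add: fun_eq_iff)
    qed
  qed (simp add: fun_eq_iff)
  have i: "(\<forall>i\<le>d. \<forall>j\<le>d. j > i + 1 \<longrightarrow> E i \<circ> As \<circ> E j = (\<lambda>_. 0)) \<longleftrightarrow> ?iii"
    unfolding comp by (rule tridiagonal_iff_recurrent[OF sb assms(1,6,7) vartheta])
  have ii: "(\<forall>i\<le>d. \<forall>j\<le>d. j > i + 1 \<longrightarrow> Es i \<circ> A \<circ> Es j = (\<lambda>_. 0)) \<longleftrightarrow> ?iii"
    unfolding comp by (rule star_tridiagonal_iff_recurrent[OF sb assms(1,6,7) vartheta])
  have "tridiagonal_hessenberg_system d A E As Es \<longleftrightarrow>
      (\<forall>i\<le>d. \<forall>j\<le>d. j > i + 1 \<longrightarrow> E i \<circ> As \<circ> E j = (\<lambda>_. 0)) \<and>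
      (\<forall>i\<le>d. \<forall>j\<le>d. j > i + 1 \<longrightarrow> Es i \<circ> A \<circ> Es j = (\<lambda>_. 0))"
    using assms(4) unfolding tridiagonal_hessenberg_system_def by blast
  then have iv: "tridiagonal_hessenberg_system d A E As Es \<longleftrightarrow> ?iii" unfolding i ii by simp
  show ?thesis unfolding Let_def i ii iv by simp
qed

end
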